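(* Let $F$ be a foliation on $M$, $T$ a transversal, and $\omega$ a smooth nonvanishing positive density on $T$ which is projectively invariant under $G_T$ (i.e. $\delta^{(\omega)}$ is locally constant on $G_T$). Then the transverse fundamental cocycle $\phi$ on $C_c^\infty(\mathrm{SMet}^{(\omega)}_\tau(G_T))$ is invariant under the one-parameter automorphism group $\sigma_t$: $\phi(\sigma_t(f^0),\ldots,\sigma_t(f^{q'}))=\phi(f^0,\ldots,f^{q'})$ for all $t\in\mathbb{R}$ and all $f^0,\ldots,f^{q'}\in C_c^\infty(\mathrm{SMet}^{(\omega)}_\tau(G_T))$.
   Context: $M$ is a smooth oriented manifold of dimension $n$, $F$ a smooth oriented foliation of dimension $p$ on $M$, $\tau=\mathrm{T}M/F$, $q=n-p$, and $G$ the holonomy groupoid with range and source maps $r,s$. $T\subset M$ is a $q$-dimensional transversal and $G_T=\{\gamma\in G\mid r\gamma,s\gamma\in T\}$, an étale groupoid over $T$, possibly non-Hausdorff ($C_c^\infty$ denotes the span of functions smooth and compactly supported on Euclidean open sets). One identifies $\mathrm{T}T$ with $\tau|_T$; $G_T$ acts on it by holonomy. For a density $\omega$ on $T$, $\delta^{(\omega)}:G_T\to\mathbb{R}_{>0}$ is defined by $\omega_{s\gamma}=\delta^{(\omega)}(\gamma)\gamma^*\omega_{r\gamma}$. $\mathrm{Met}_\tau(T)$ is the bundle over $T$ of positive definite quadratic forms on the spaces $\tau_x$, with its natural $G_T$-action. $\mathrm{SMet}^{(\omega)}_\tau(T)\subset\mathrm{Met}_\tau(T)$ is the set of forms whose associated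 density is $\omega$; $\gamma\in G_T$ acts on it by sending $\xi$ to the unique positive multiple of $\gamma\cdot\xi$ lying in $\mathrm{SMet}^{(\omega)}_\tau(T)$; $\mathrm{SMet}^{(\omega)}_\tau(G_T)=G_T\ltimes\mathrm{SMet}^{(\omega)}_\tau(T)$, an étale groupoid. Put $q'=\dim\mathrm{SMet}^{(\omega)}_\tau(T)=q(q+1)/2+q-1$. The function $\delta^{(\omega)}$ is pulled back to this groupoid, and $\sigma_t(f)=(\delta^{(\omega)})^{it}f$ (pointwise product). The transverse fundamental cocycle is the cyclic $q'$-cocycle $$\phi(f^0,\ldots,f^{q'})=\int_{\gamma_0\cdots\gamma_{q'}\in\mathrm{SMet}^{(\omega)}_\tau(T)}f^0_{\gamma_0}\,df^1_{\gamma_1}\cdots df^{q'}_{\gamma_{q'}},$$ i.e. the integral over the unit space of the restriction to units of the convolution product of $f^0$ and the forms $df^j$, where forms on the étale groupoid are convolved by $(\omega_1*\omega_2)(\gamma)=\sum_{\gamma=\gamma'\gamma''}\omega_1(\gamma')\wedge\gamma'\cdot\omega_2(\gamma'')$, cotangent spaces at an arrow being identified with those at its range. *)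

theory Defs
  imports "HOL-Analysis.Analysis"
begin

section \<open>Smooth maps and charts\<close>

primrec Ck_on :: "nat \<Rightarrow> 'a::real_normed_vector set \<Rightarrow> ('a \<Rightarrow> 'b::real_normed_vector) \<Rightarrow> bool" where
  "Ck_on 0 S f \<longleftrightarrow> continuous_on S f"
| "Ck_on (Suc k) S f \<longleftrightarrow> (\<forall>x\<in>S. f differentiable (at x)) \<and>
     (\<forall>v. Ck_on k S (\<lambda>x. frechet_derivative f (at x) v))"

text \<open>Only used for open sets \<open>S\<close> of finite-dimensional spaces.\<close>

definition smooth_on :: "'a::real_normed_vector set \<Rightarrow> ('a \<Rightarrow> 'b::real_normed_vector) \<Rightarrow> bool" where
  "smooth_on S f \<longleftrightarrow> (\<forall>k. Ck_on k S f)"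

text \<open>A chart is a domain together with a coordinate map, whose values off the domain are
  irrelevant.\<close>

type_synonym ('a, 'e) chart = "'a set \<times> ('a \<Rightarrow> 'e)"

definition transition :: "('a, 'e) chart \<Rightarrow> ('a, 'e) chart \<Rightarrow> 'e \<Rightarrow> 'e" where
  "transition c c' = snd c' \<circ> inv_into (fst c) (snd c)"

text \<open>A tangent vector at \<open>x\<close> is the family of its components in all charts around \<open>x\<close>
  (and \<open>0\<close> for the other indices), related by the derivatives of the transition maps.\<close>

definition tangent_space ::
  "('a, 'e::real_normed_vector) chart set \<Rightarrow> 'a \<Rightarrow> (('a, 'e) chart \<Rightarrow> 'e) set" where
  "tangent_space \<C> x = {v.
     (\<forall>c\<in>\<C>. \<forall>c'\<in>\<C>. x \<in> fst c \<longrightarrow> x \<in> fst c' \<longrightarrow>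
        v c' = frechet_derivative (transition c c') (at (snd c x)) (v c)) \<and>
     (\<forall>c. c \<notin> \<C> \<or> x \<notin> fst c \<longrightarrow> v c = 0)}"

definition tangent_of_coords ::
  "('a, 'e::real_normed_vector) chart set \<Rightarrow> 'a \<Rightarrow> ('a, 'e) chart \<Rightarrow> 'e \<Rightarrow> (('a, 'e) chart \<Rightarrow> 'e)" where
  "tangent_of_coords \<C> x c e = (THE v. v \<in> tangent_space \<C> x \<and> v c = e)"


section \<open>Quadratic forms and densities\<close>

text \<open>Vectors are families \<open>'c \<Rightarrow> real^'q\<close>, with componentwise operations.\<close>

definition polar :: "(('c \<Rightarrow> real^'q) \<Rightarrow> real) \<Rightarrow> ('c \<Rightarrow> real^'q) \<Rightarrow> ('c \<Rightarrow> real^'q) \<Rightarrow> real" where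
  "polar Q u v = (Q (\<lambda>c. u c + v c) - Q u - Q v) / 2"

definition pos_def_quadratic_form ::
  "('c \<Rightarrow> real^'q) set \<Rightarrow> (('c \<Rightarrow> real^'q) \<Rightarrow> real) \<Rightarrow> bool" where
  "pos_def_quadratic_form E Q \<longleftrightarrow>
     (\<forall>u. u \<notin> E \<longrightarrow> Q u = 0) \<and>
     (\<forall>u\<in>E. \<forall>a. Q (\<lambda>c. a *\<^sub>R u c) = a\<^sup>2 * Q u) \<and>
     (\<forall>u\<in>E. \<forall>v\<in>E. \<forall>w\<in>E. \<forall>a. polar Q (\<lambda>c. a *\<^sub>R u c + v c) w = a * polar Q u w + polar Q v w) \<and>
     (\<forall>u\<in>E. u \<noteq> (\<lambda>_. 0) \<longrightarrow> Q u > 0)"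

text \<open>A density on a \<open>q\<close>-dimensional space is a function of \<open>q\<close>-tuples of vectors on which
  matrices act through \<open>\<bar>det\<bar>\<close>; its values on tuples outside \<open>E\<close> are irrelevant.\<close>

definition positive_density ::
  "('c \<Rightarrow> real^'q) set \<Rightarrow> (('q \<Rightarrow> 'c \<Rightarrow> real^'q) \<Rightarrow> real) \<Rightarrow> bool" where
  "positive_density E \<rho> \<longleftrightarrow> (\<forall>w. (\<forall>i. w i \<in> E) \<longrightarrow>
     (\<forall>B::real^'q^'q. \<rho> (\<lambda>i c. \<Sum>j\<in>UNIV. (B $ i $ j) *\<^sub>R w j c) = \<bar>det B\<bar> * \<rho> w) \<and>
     ((\<forall>a::'q \<Rightarrow> real. (\<lambda>c. \<Sum>j\<in>UNIV. a j *\<^sub>R w j c) = (\<lambda>_. 0) \<longrightarrow> a = (\<lambda>_. 0)) \<longrightarrow> \<rho> w > 0))"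

definition form_density ::
  "(('c \<Rightarrow> real^'q) \<Rightarrow> real) \<Rightarrow> ('q \<Rightarrow> 'c \<Rightarrow> real^'q) \<Rightarrow> real" where
  "form_density Q w = sqrt (det (\<chi> i j. polar Q (w i) (w j)))"


section \<open>Exterior algebra and integration of top degree forms\<close>

text \<open>A (possibly inhomogeneous) alternating form is a function on lists of vectors; a form of
  degree \<open>k\<close> vanishes on lists of length other than \<open>k\<close>. The wedge product is the sum over
  shuffles, so that \<open>(\<alpha> \<and> \<beta>)(v, w) = \<alpha> v * \<beta> w - \<alpha> w * \<beta> v\<close> for one-forms.\<close>

definition wedge :: "('v list \<Rightarrow> complex) \<Rightarrow> ('v list \<Rightarrow> complex) \<Rightarrow> 'v list \<Rightarrow> complex" where
  "wedge \<alpha> \<beta> vs = (\<Sum>S\<in>Pow {..<length vs}.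
     (-1) ^ card {(i, j). i < j \<and> j < length vs \<and> i \<notin> S \<and> j \<in> S} * \<alpha> (nths vs S) * \<beta> (nths vs (- S)))"

definition top_coefficient ::
  "('a, (real, 'k::{finite,linorder}) vec) chart set \<Rightarrow> ('a \<Rightarrow> (('a, (real,'k) vec) chart \<Rightarrow> (real,'k) vec) list \<Rightarrow> complex)
    \<Rightarrow> ('a, (real,'k) vec) chart \<Rightarrow> (real,'k) vec \<Rightarrow> complex" where
  "top_coefficient \<C> \<beta> c y = (let x = inv_into (fst c) (snd c) y in
     \<beta> x (map (\<lambda>l. tangent_of_coords \<C> x c (axis l 1)) (sorted_list_of_set UNIV)))"

text \<open>Integral of a top degree form over an oriented manifold \<open>X\<close> with oriented atlas \<open>\<C>\<close>: cut
  \<open>X\<close> into countably many measurable pieces contained in charts. The value does not depend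
  on the choices. No continuity of \<open>\<beta>\<close> is required: over a non-Hausdorff groupoid the
  integrands of interest are in general only measurable.\<close>

definition has_form_integral ::
  "('a, (real, 'k::{finite,linorder}) vec) chart set \<Rightarrow> 'a set
    \<Rightarrow> ('a \<Rightarrow> (('a, (real,'k) vec) chart \<Rightarrow> (real,'k) vec) list \<Rightarrow> complex) \<Rightarrow> complex \<Rightarrow> bool" where
  "has_form_integral \<C> X \<beta> I \<longleftrightarrow> (\<exists>c B.
     (\<forall>i::nat. c i \<in> \<C> \<and> B i \<subseteq> fst (c i) \<and> snd (c i) ` B i \<in> sets lebesgue \<and>
        set_integrable lebesgue (snd (c i) ` B i) (top_coefficient \<C> \<beta> (c i))) \<and>
     disjoint_family B \<and> (\<Union>i. B i) = X \<and>
     summable (\<lambda>i. LINT y:snd (c i) ` B i|lebesgue. norm (top_coefficient \<C> \<beta> (c i) y)) \<and>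
     (\<lambda>i. LINT y:snd (c i) ` B i|lebesgue. top_coefficient \<C> \<beta> (c i) y) sums I)"


section \<open>Foliations\<close>

text \<open>The model of a foliation of codimension \<open>q\<close> of an \<open>n\<close>-manifold is \<open>real^'n\<close> with a choice
  \<open>b :: 'q \<Rightarrow> 'n\<close> of the transverse coordinates; the other \<open>p = n - q\<close> coordinates are the
  leafwise ones.\<close>

definition transverse_part :: "('q::finite \<Rightarrow> 'n::finite) \<Rightarrow> real^'n \<Rightarrow> real^'q" where
  "transverse_part b v = (\<chi> j. v $ b j)"

definition leafwise_block :: "('q::finite \<Rightarrow> 'n::finite) \<Rightarrow> real^'n^'n \<Rightarrow> real^'n^'n" where
  "leafwise_block b J = (\<chi> i j. if i \<notin> range b \<and> j \<notin> range b then J $ i $ j else if i = j then 1 else 0)"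

text \<open>An oriented foliated atlas: a smooth atlas of \<open>M = UNIV :: 'm set\<close> whose transition maps
  locally have the form \<open>(x, y) \<mapsto> (g(x, y), k(y))\<close>, with positive Jacobian determinants on \<open>TM\<close>
  and on the tangent bundle \<open>F\<close> of the leaves (the kernel of the transverse part).\<close>

definition oriented_foliated_atlas ::
  "('m::topological_space, real^'n::finite) chart set \<Rightarrow> ('q::finite \<Rightarrow> 'n) \<Rightarrow> bool" where
  "oriented_foliated_atlas \<A> b \<longleftrightarrow> inj b \<and> (\<Union>c\<in>\<A>. fst c) = UNIV \<and>
     (\<forall>c\<in>\<A>. open (fst c) \<and> open (snd c ` fst c) \<and>
        (\<exists>\<psi>. homeomorphism (fst c) (snd c ` fst c) (snd c) \<psi>)) \<and>
     (\<forall>c\<in>\<A>. \<forall>c'\<in>\<A>.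
        smooth_on (snd c ` (fst c \<inter> fst c')) (transition c c') \<and>
        (\<forall>x \<in> fst c \<inter> fst c'.
          (\<exists>k. \<forall>\<^sub>F z in nhds x. transverse_part b (snd c' z) = k (transverse_part b (snd c z))) \<and>
          (let J = matrix (frechet_derivative (transition c c') (at (snd c x)))
           in det J > 0 \<and> det (leafwise_block b J) > 0)))"

text \<open>A vector of \<open>\<tau>\<^sub>x\<close> is a family of coordinate vectors indexed by the foliated charts, a point
  \<open>(x, \<xi>)\<close> of the bundle of metrics consists of a point of the transversal and a function on
  \<open>\<tau>\<^sub>x\<close>, and an arrow is a holonomy class of leafwise paths together with such a point.\<close>

type_synonym ('m, 'n, 'q) normal_vec = "('m, (real, 'n) vec) chart \<Rightarrow> (real, 'q) vec"
type_synonym ('m, 'n, 'q) met_point = "'m \<times> (('m, 'n, 'q) normal_vec \<Rightarrow> real)"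
type_synonym ('m, 'n, 'q) arrow = "(real \<Rightarrow> 'm) set \<times> ('m, 'n, 'q) met_point"
type_synonym ('m, 'n, 'q, 'k) met_chart = "(('m, 'n, 'q) met_point, (real, 'k) vec) chart"
type_synonym ('m, 'n, 'q, 'k) met_tvec = "('m, 'n, 'q, 'k) met_chart \<Rightarrow> (real, 'k) vec"
type_synonym ('m, 'n, 'q, 'k) arrow_form =
  "('m, 'n, 'q) arrow \<Rightarrow> ('m, 'n, 'q, 'k) met_tvec list \<Rightarrow> complex"

text \<open>The data are: a foliated atlas \<open>\<A>\<close> with transverse indices \<open>b\<close>, a transversal \<open>T\<close>, a density
  \<open>\<omega>\<close> on \<open>T\<close>, and a linear map \<open>L\<close> whose only purpose is to fix an orientation of
  \<open>R^q + Sym(q)\<close>. The conditions on them are the predicates defined below.\<close>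

locale transversal_data =
  fixes \<A> :: "('m::{t2_space,second_countable_topology}, real^'n::finite) chart set"
    and b :: "'q::finite \<Rightarrow> 'n"
    and T :: "'m set"
    and \<omega> :: "'m \<Rightarrow> ('q \<Rightarrow> ('m, real^'n) chart \<Rightarrow> real^'q) \<Rightarrow> real"
    and L :: "(real^'q) \<times> (real^'q^'q) \<Rightarrow> (real, 'k::{finite,linorder} option) vec"
begin

definition trc :: "('m, real^'n) chart \<Rightarrow> 'm \<Rightarrow> real^'q" where
  "trc c x = transverse_part b (snd c x)"

text \<open>\<open>\<tau>\<^sub>x = T\<^sub>xM / F\<^sub>x\<close>, realised as the image of \<open>T\<^sub>xM\<close> under taking the transverse part in all
  foliated charts; the kernel of this map is \<open>F\<^sub>x\<close>. For \<open>x \<in> T\<close> this is also \<open>T\<^sub>xT\<close>.\<close>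

definition \<tau> :: "'m \<Rightarrow> ('m,'n,'q) normal_vec set" where
  "\<tau> x = (\<lambda>v c. transverse_part b (v c)) ` tangent_space \<A> x"

definition \<tau>_of_coords :: "'m \<Rightarrow> ('m, real^'n) chart \<Rightarrow> real^'q \<Rightarrow> ('m,'n,'q) normal_vec" where
  "\<tau>_of_coords x c e = (THE w. w \<in> \<tau> x \<and> w c = e)"

text \<open>An embedded \<open>q\<close>-dimensional submanifold \<open>T\<close>, locally parametrised by \<open>\<sigma>\<close>. The last condition
  says that \<open>\<sigma>\<close> is an immersion with image transverse to \<open>F\<close>.\<close>

definition transversal :: bool where
  "transversal \<longleftrightarrow> (\<forall>x\<in>T. \<exists>V W \<sigma> \<rho>. open V \<and> x \<in> V \<and> open (W :: (real^'q) set) \<and>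
     homeomorphism W (T \<inter> V) \<sigma> \<rho> \<and>
     (\<forall>c\<in>\<A>. smooth_on (W \<inter> \<sigma> -` fst c) (snd c \<circ> \<sigma>) \<and>
        (\<forall>y \<in> W \<inter> \<sigma> -` fst c. \<forall>v.
           transverse_part b (frechet_derivative (snd c \<circ> \<sigma>) (at y) v) = 0 \<longrightarrow> v = 0)))"

text \<open>Smoothness of \<open>\<omega>\<close> is tested on the coordinate frames, as a function of the transverse
  coordinates, which are local coordinates on \<open>T\<close>.\<close>

definition smooth_positive_density :: bool where
  "smooth_positive_density \<longleftrightarrow> (\<forall>x\<in>T. positive_density (\<tau> x) (\<omega> x) \<and>
     (\<forall>c\<in>\<A>. x \<in> fst c \<longrightarrow> (\<exists>V W g. open V \<and> x \<in> V \<and> open W \<and> smooth_on W g \<and>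
        (\<forall>z \<in> V \<inter> T. z \<in> fst c \<and> trc c z \<in> W \<and>
           \<omega> z (\<lambda>i. \<tau>_of_coords z c (axis i 1)) = g (trc c z)))))"


section \<open>The holonomy groupoid\<close>

definition leafwise_path :: "(real \<Rightarrow> 'm) \<Rightarrow> bool" where
  "leafwise_path \<gamma> \<longleftrightarrow> path \<gamma> \<and>
     (\<forall>t\<in>{0..1}. \<forall>c\<in>\<A>. \<gamma> t \<in> fst c \<longrightarrow>
        (\<forall>\<^sub>F t' in at t within {0..1}. trc c (\<gamma> t') = trc c (\<gamma> t)))"

text \<open>\<open>holonomy_chain \<gamma> c d t h\<close>: \<open>h\<close> is the composition of the transverse coordinate changes along
  a chain of foliated charts, starting with \<open>c\<close> and ending with \<open>d\<close>, which covers the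
  restriction of \<open>\<gamma>\<close> to \<open>{0..t}\<close>.\<close>

inductive holonomy_chain ::
  "(real \<Rightarrow> 'm) \<Rightarrow> ('m, real^'n) chart \<Rightarrow> ('m, real^'n) chart \<Rightarrow> real \<Rightarrow> (real^'q \<Rightarrow> real^'q) \<Rightarrow> bool"
  for \<gamma> and c where
  start: "c \<in> \<A> \<Longrightarrow> \<gamma> 0 \<in> fst c \<Longrightarrow> holonomy_chain \<gamma> c c 0 (\<lambda>y. y)"
| plaque: "holonomy_chain \<gamma> c d s h \<Longrightarrow> s \<le> t \<Longrightarrow> t \<le> 1 \<Longrightarrow> \<gamma> ` {s..t} \<subseteq> fst d \<Longrightarrow>
    holonomy_chain \<gamma> c d t h"
| change: "holonomy_chain \<gamma> c d t h \<Longrightarrow> e \<in> \<A> \<Longrightarrow> \<gamma> t \<in> fst e \<Longrightarrow>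
    \<forall>\<^sub>F z in nhds (\<gamma> t). trc e z = k (trc d z) \<Longrightarrow> holonomy_chain \<gamma> c e t (k \<circ> h)"

text \<open>The holonomy of \<open>\<gamma>\<close>, read in charts \<open>c\<close> and \<open>d\<close> around its end points, is a germ at
  \<open>trc c (\<gamma> 0)\<close>.\<close>

definition has_holonomy ::
  "(real \<Rightarrow> 'm) \<Rightarrow> ('m, real^'n) chart \<Rightarrow> ('m, real^'n) chart \<Rightarrow> (real^'q \<Rightarrow> real^'q) \<Rightarrow> bool" where
  "has_holonomy \<gamma> c d h \<longleftrightarrow>
     (\<exists>h'. holonomy_chain \<gamma> c d 1 h' \<and> (\<forall>\<^sub>F y in nhds (trc c (\<gamma> 0)). h y = h' y))"

definition holonomy_equiv :: "(real \<Rightarrow> 'm) \<Rightarrow> (real \<Rightarrow> 'm) \<Rightarrow> bool" where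
  "holonomy_equiv \<gamma> \<gamma>' \<longleftrightarrow> leafwise_path \<gamma> \<and> leafwise_path \<gamma>' \<and>
     pathstart \<gamma> = pathstart \<gamma>' \<and> pathfinish \<gamma> = pathfinish \<gamma>' \<and>
     (\<forall>c d h. has_holonomy \<gamma> c d h \<longleftrightarrow> has_holonomy \<gamma>' c d h)"

definition hol_class :: "(real \<Rightarrow> 'm) \<Rightarrow> (real \<Rightarrow> 'm) set" where
  "hol_class \<gamma> = {\<gamma>'. holonomy_equiv \<gamma> \<gamma>'}"

definition G :: "(real \<Rightarrow> 'm) set set" where
  "G = hol_class ` {\<gamma>. leafwise_path \<gamma>}"

definition src :: "(real \<Rightarrow> 'm) set \<Rightarrow> 'm" where
  "src g = pathstart (SOME \<gamma>. \<gamma> \<in> g)"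

definition rng :: "(real \<Rightarrow> 'm) set \<Rightarrow> 'm" where
  "rng g = pathfinish (SOME \<gamma>. \<gamma> \<in> g)"

text \<open>Arrows compose like maps: \<open>comp g g'\<close> is \<open>g'\<close> followed by \<open>g\<close>.\<close>

definition comp :: "(real \<Rightarrow> 'm) set \<Rightarrow> (real \<Rightarrow> 'm) set \<Rightarrow> (real \<Rightarrow> 'm) set" where
  "comp g g' = {\<gamma>. \<exists>\<gamma>\<^sub>1\<in>g. \<exists>\<gamma>\<^sub>2\<in>g'. holonomy_equiv \<gamma> (\<gamma>\<^sub>2 +++ \<gamma>\<^sub>1)}"

definition ident :: "'m \<Rightarrow> (real \<Rightarrow> 'm) set" where
  "ident x = hol_class (\<lambda>_. x)"

definition G_T :: "(real \<Rightarrow> 'm) set set" where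
  "G_T = {g \<in> G. src g \<in> T \<and> rng g \<in> T}"

text \<open>The etale topology of \<open>G_T\<close>. If \<open>V\<close> and \<open>V'\<close> are so small that the transverse coordinates are
  injective on \<open>T \<inter> V\<close> and \<open>T \<inter> V'\<close>, then a generating set below is a bisection: it consists of
  the arrows with the holonomy germs of one and the same local diffeomorphism \<open>h\<close>.\<close>

definition G_T_topology :: "(real \<Rightarrow> 'm) set topology" where
  "G_T_topology = topology_generated_by
     {{g \<in> G_T. src g \<in> V \<and> rng g \<in> V' \<and> (\<exists>\<gamma>\<in>g. has_holonomy \<gamma> c d h)} | V V' c d h.
        open V \<and> open V'}"

text \<open>The action \<open>\<tau>\<^sub>s\<^sub>g \<rightarrow> \<tau>\<^sub>r\<^sub>g\<close> by the differential of the holonomy.\<close>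

definition hol_act :: "(real \<Rightarrow> 'm) set \<Rightarrow> ('m,'n,'q) normal_vec \<Rightarrow> ('m,'n,'q) normal_vec" where
  "hol_act g w = (THE w'. w' \<in> \<tau> (rng g) \<and>
     (\<forall>\<gamma>\<in>g. \<forall>c d h. has_holonomy \<gamma> c d h \<longrightarrow>
        w' d = frechet_derivative h (at (trc c (src g))) (w c)))"

definition \<delta> :: "(real \<Rightarrow> 'm) set \<Rightarrow> real" where
  "\<delta> g = (THE a. \<forall>w. (\<forall>i. w i \<in> \<tau> (src g)) \<longrightarrow>
     \<omega> (src g) w = a * \<omega> (rng g) (\<lambda>i. hol_act g (w i)))"

definition projectively_invariant :: bool where
  "projectively_invariant \<longleftrightarrow>
     (\<forall>g\<in>G_T. \<exists>N. openin G_T_topology N \<and> g \<in> N \<and> (\<forall>g'\<in>N. \<delta> g' = \<delta> g))"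


section \<open>The bundle of metrics with density \<open>\<omega>\<close>\<close>

definition SMet :: "('m,'n,'q) met_point set" where
  "SMet = {(x, \<xi>). x \<in> T \<and> pos_def_quadratic_form (\<tau> x) \<xi> \<and>
     (\<forall>w. (\<forall>i. w i \<in> \<tau> x) \<longrightarrow> form_density \<xi> w = \<omega> x w)}"

definition form_matrix ::
  "('m, real^'n) chart \<Rightarrow> ('m,'n,'q) met_point \<Rightarrow> real^'q^'q" where
  "form_matrix c u =
     (\<chi> i j. polar (snd u) (\<tau>_of_coords (fst u) c (axis i 1)) (\<tau>_of_coords (fst u) c (axis j 1)))"

definition SMet_topology :: "('m,'n,'q) met_point topology" where
  "SMet_topology = topology_generated_by
     {{u \<in> SMet. fst u \<in> fst c \<and> (fst u, form_matrix c u) \<in> W} | c W. c \<in> \<A> \<and> open W}"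

definition Met_coords ::
  "('m, real^'n) chart \<Rightarrow> ('m,'n,'q) met_point \<Rightarrow> (real^'q) \<times> (real^'q^'q)" where
  "Met_coords c u = (trc c (fst u), form_matrix c u)"

text \<open>An orientation of \<open>R^q + Sym(q)\<close>, of dimension \<open>q' + 1\<close>, is given by a linear isomorphism with
  \<open>real^('k option)\<close>, where \<open>'k\<close> has \<open>q'\<close> elements. Orientation-preserving changes of basis in
  \<open>R^q\<close> act on \<open>R^q + Sym(q)\<close> with positive determinant, so this orients \<open>Met\<^sub>\<tau>(T)\<close> when \<open>\<tau>\<close> is
  oriented.\<close>

definition fixes_orientation :: bool where
  "fixes_orientation \<longleftrightarrow> linear L \<and> inj_on L {(v, B). transpose B = B}"

text \<open>The oriented charts of \<open>SMet\<close>, as an embedded submanifold of \<open>Met\<^sub>\<tau>(T)\<close>: inverses of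
  smooth regular parametrisations. \<open>SMet\<close> is oriented as a hypersurface of \<open>Met\<^sub>\<tau>(T)\<close>, with the
  radial direction \<open>(0, \<xi>)\<close> as normal direction. The holonomy action preserves this orientation.\<close>

definition SMet_charts :: "('m,'n,'q,'k) met_chart set" where
  "SMet_charts = {(V, \<kappa>). openin SMet_topology V \<and> open (\<kappa> ` V) \<and>
     homeomorphic_map (subtopology SMet_topology V) (top_of_set (\<kappa> ` V)) \<kappa> \<and>
     (\<forall>c\<in>\<A>. let D = \<kappa> ` {u \<in> V. fst u \<in> fst c}; P = Met_coords c \<circ> inv_into V \<kappa> in
        smooth_on D P \<and>
        (\<forall>y\<in>D. inj (frechet_derivative P (at y)) \<and>
           det (\<chi> i j. case j of
                  None \<Rightarrow> L (0, snd (P y)) $ i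
                | Some l \<Rightarrow> L (frechet_derivative P (at y) (axis l 1)) $ i) > 0))}"


section \<open>The etale groupoid of \<open>G_T\<close> acting on the bundle of metrics\<close>

text \<open>The unique positive multiple of \<open>g \<cdot> \<xi>\<close> with density \<open>\<omega>\<close>.\<close>

definition SMet_act ::
  "(real \<Rightarrow> 'm) set \<Rightarrow> ('m,'n,'q) met_point \<Rightarrow> ('m,'n,'q) met_point" where
  "SMet_act g u = (THE u'. u' \<in> SMet \<and> (\<exists>a>0. u' = (rng g,
     \<lambda>w. if w \<in> \<tau> (rng g) then a * snd u (inv_into (\<tau> (src g)) (hol_act g) w) else 0)))"

text \<open>An arrow \<open>(g, u)\<close> goes from \<open>u\<close> to \<open>g \<cdot> u\<close>.\<close>

definition arrows :: "('m,'n,'q) arrow set" where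
  "arrows = {(g, u). g \<in> G_T \<and> u \<in> SMet \<and> src g = fst u}"

definition asrc :: "('m,'n,'q) arrow \<Rightarrow> ('m,'n,'q) met_point" where
  "asrc = snd"

definition arng :: "('m,'n,'q) arrow \<Rightarrow> ('m,'n,'q) met_point" where
  "arng = (\<lambda>(g, u). SMet_act g u)"

definition amult ::
  "('m,'n,'q) arrow \<Rightarrow> ('m,'n,'q) arrow \<Rightarrow> ('m,'n,'q) arrow" where
  "amult a a' = (comp (fst a) (fst a'), snd a')"

definition unit_arrow :: "('m,'n,'q) met_point \<Rightarrow> ('m,'n,'q) arrow" where
  "unit_arrow u = (ident (fst u), u)"

definition arrow_topology :: "('m,'n,'q) arrow topology" where
  "arrow_topology = subtopology (prod_topology G_T_topology SMet_topology) arrows"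

text \<open>Euclidean open sets \<open>N\<close> of arrows, with coordinates \<open>\<kappa> \<circ> arng\<close> for a chart \<open>(V, \<kappa>)\<close> of the
  unit space. Tangent spaces at an arrow are thereby identified with those at its range.\<close>

definition arrow_charts :: "(('m,'n,'q) arrow set \<times> ('m,'n,'q,'k) met_chart) set" where
  "arrow_charts = {(N, (V, \<kappa>)). openin arrow_topology N \<and> (V, \<kappa>) \<in> SMet_charts \<and>
     arng ` N \<subseteq> V \<and> open (\<kappa> ` arng ` N) \<and>
     homeomorphic_map (subtopology arrow_topology N) (top_of_set (\<kappa> ` arng ` N)) (\<kappa> \<circ> arng)}"

text \<open>The map \<open>T\<^sub>r\<^sub>a \<rightarrow> T\<^sub>s\<^sub>a\<close> inverse to the differential of the action of the arrow \<open>a\<close>, i.e. the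
  differential of \<open>asrc \<circ> (arng restricted to N)\<inverse>\<close> for a small open neighbourhood \<open>N\<close> of \<open>a\<close>.\<close>

definition pull_tangent ::
  "('m,'n,'q) arrow \<Rightarrow> ('m,'n,'q,'k) met_tvec \<Rightarrow> ('m,'n,'q,'k) met_tvec" where
  "pull_tangent a v = (THE w. w \<in> tangent_space SMet_charts (asrc a) \<and>
     (\<forall>(N, c) \<in> arrow_charts. \<forall>c' \<in> SMet_charts. a \<in> N \<longrightarrow> asrc a \<in> fst c' \<longrightarrow>
        w c' = frechet_derivative (snd c' \<circ> asrc \<circ> inv_into N (snd c \<circ> arng)) (at (snd c (arng a))) (v c)))"

text \<open>A function that is smooth with compact support on the Euclidean open set \<open>N\<close>, extended
  by \<open>0\<close>, and its differential.\<close>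

definition elementary ::
  "('m,'n,'q) arrow set \<times> ('m,'n,'q,'k) met_chart
    \<Rightarrow> (('m,'n,'q) arrow \<Rightarrow> complex) \<Rightarrow> bool" where
  "elementary = (\<lambda>(N, c) f. (N, c) \<in> arrow_charts \<and> (\<forall>a. a \<notin> N \<longrightarrow> f a = 0) \<and>
     smooth_on (snd c ` arng ` N) (f \<circ> inv_into N (snd c \<circ> arng)) \<and>
     (\<exists>K. compact K \<and> K \<subseteq> snd c ` arng ` N \<and> (\<forall>a\<in>N. snd c (arng a) \<notin> K \<longrightarrow> f a = 0)))"

definition elementary_diff ::
  "('m,'n,'q) arrow set \<times> ('m,'n,'q,'k) met_chart
    \<Rightarrow> (('m,'n,'q) arrow \<Rightarrow> complex)
    \<Rightarrow> ('m,'n,'q,'k) arrow_form" where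
  "elementary_diff = (\<lambda>(N, c) f a vs. case vs of
       [v] \<Rightarrow> if a \<in> N
              then frechet_derivative (f \<circ> inv_into N (snd c \<circ> arng)) (at (snd c (arng a))) (v c)
              else 0
     | _ \<Rightarrow> 0)"

definition Cc_smooth :: "(('m,'n,'q) arrow \<Rightarrow> complex) set" where
  "Cc_smooth = {f. \<exists>n C F. (\<forall>i<n::nat. elementary (C i) (F i)) \<and> f = (\<lambda>a. \<Sum>i<n. F i a)}"

text \<open>The differential of \<open>f = \<Sum> F\<^sub>i\<close> is \<open>\<Sum> dF\<^sub>i\<close>. On a non-Hausdorff groupoid the pointwise value of
  this sum depends on the decomposition of \<open>f\<close>, but only on a set of measure zero: where
  exactly the domains of the \<open>F\<^sub>i\<close> with \<open>i \<in> J\<close> meet, two decompositions differ by a smooth function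
  vanishing on that set, whose derivative vanishes at the density points of the set. This is why
  the differential is a relation.\<close>

definition is_differential ::
  "(('m,'n,'q) arrow \<Rightarrow> complex)
    \<Rightarrow> ('m,'n,'q,'k) arrow_form \<Rightarrow> bool" where
  "is_differential f \<theta> \<longleftrightarrow> (\<exists>n C F. (\<forall>i<n::nat. elementary (C i) (F i)) \<and>
     f = (\<lambda>a. \<Sum>i<n. F i a) \<and> \<theta> = (\<lambda>a vs. \<Sum>i<n. elementary_diff (C i) (F i) a vs))"

text \<open>In \<open>convolve\<close> only finitely many terms are nonzero for the forms considered.\<close>

definition convolve ::
  "('m,'n,'q,'k) arrow_form \<Rightarrow> ('m,'n,'q,'k) arrow_form \<Rightarrow> ('m,'n,'q,'k) arrow_form" where
  "convolve \<theta>\<^sub>1 \<theta>\<^sub>2 a vs =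
     (\<Sum>\<^sub>\<infinity>(a', a'') \<in> {(a', a''). a' \<in> arrows \<and> a'' \<in> arrows \<and> asrc a' = arng a'' \<and> a = amult a' a''}.
        wedge (\<theta>\<^sub>1 a') (\<lambda>ws. \<theta>\<^sub>2 a'' (map (pull_tangent a') ws)) vs)"

primrec cocycle_product ::
  "(('m,'n,'q) arrow \<Rightarrow> complex)
    \<Rightarrow> (nat \<Rightarrow> ('m,'n,'q,'k) arrow_form) \<Rightarrow> nat \<Rightarrow> ('m,'n,'q,'k) arrow_form" where
  "cocycle_product f0 \<theta> 0 = (\<lambda>a vs. if vs = [] then f0 a else 0)"
| "cocycle_product f0 \<theta> (Suc j) = convolve (cocycle_product f0 \<theta> j) (\<theta> (Suc j))"

text \<open>The transverse fundamental cocycle \<open>\<phi>(f 0, \<dots>, f q')\<close>, with \<open>q' = CARD('k)\<close>. The choices of the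
  differentials do not affect the integral.\<close>

definition \<phi> ::
  "(nat \<Rightarrow> ('m,'n,'q) arrow \<Rightarrow> complex) \<Rightarrow> complex" where
  "\<phi> f = (THE I. \<exists>\<theta>. (\<forall>j\<in>{1..CARD('k)}. is_differential (f j) (\<theta> j)) \<and>
     has_form_integral SMet_charts SMet
       (\<lambda>u. cocycle_product (f 0) \<theta> CARD('k) (unit_arrow u)) I)"

definition \<sigma> ::
  "real \<Rightarrow> (('m,'n,'q) arrow \<Rightarrow> complex)
    \<Rightarrow> ('m,'n,'q) arrow \<Rightarrow> complex" where
  "\<sigma> t f = (\<lambda>a. complex_of_real (\<delta> (fst a)) powr (\<i> * complex_of_real t) * f a)"

end

end

theory Submission
  imports Defs
begin

text \<open>The function \<open>\<delta>\<close> is a homomorphism from the groupoid to the positive reals, because \<open>\<omega>\<close> is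
  transported by a groupoid action. Hence multiplication by \<open>\<delta>\<^sup>i\<^sup>t\<close> is multiplicative for the
  convolution of forms, and it commutes with the differential since \<open>\<delta>\<close> is locally constant. The
  product of \<open>f\<^sup>0\<close> and the \<open>df\<^sup>j\<close> is therefore multiplied by \<open>\<delta>\<^sup>i\<^sup>t\<close>, which is \<open>1\<close> on the units, where
  the cocycle is evaluated.

  The action of \<open>\<gamma>\<close> on \<open>\<tau>\<close> is obtained from flat sections of \<open>\<tau>\<close> along \<open>\<gamma>\<close>: every chain of charts
  covering \<open>\<gamma>\<close> computes the end value of a flat section, so that the result does not depend on the
  chain, and flat sections can be concatenated.\<close>

section \<open>Transverse coordinate changes\<close>

text \<open>\<open>hol_act\<close>, \<open>\<delta>\<close> and \<open>SMet_act\<close> are definite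
  descriptions, so little can be said about them before existence and uniqueness of the described
  object are proved. For \<open>\<delta>\<close> this is the fact that positive densities on one
  space are proportional. For the action on metrics it matters because composable arrows are only
  known to satisfy \<open>asrc a' = arng a''\<close>, an equation between metrics: the homomorphism
  property of \<open>\<delta>\<close> applies once the base point of \<open>SMet_act g u\<close> is
  known to be \<open>rng g\<close>, and this requires solving for the normalising factor. Scaling a
  form by \<open>a\<close> scales its density by a^(q/2), and transport by \<open>g\<close>
  contributes \<delta>(g), so the factor is \<delta>(g)^(-2/q). The value of \<open>\<phi>\<close>
  is also a definite description, whose predicate leaves the differentials free. The two values are
  equal because the predicates for \<open>f\<close> and for its image under
  \<open>\<sigma> t\<close> hold for the same numbers: multiplying the chosen differentials by the
  phase gives one implication, and the converse is the same implication for \<open>- t\<close>,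
  since \<open>\<sigma> (- t)\<close> undoes \<open>\<sigma> t\<close>.\<close>

lemma has_derivative_cong_nhds:
  assumes "\<forall>\<^sub>F y in nhds x. f y = g y" "(g has_derivative D) (at x)"
  shows "(f has_derivative D) (at x)"
proof -
  obtain U where "open U" "x \<in> U" "\<forall>y\<in>U. f y = g y"
    using assms(1) by (auto simp: eventually_nhds)
  then show ?thesis
    using has_derivative_transform_within_open[OF assms(2), of U f] by auto
qed

locale foliated_data = transversal_data \<A> b T \<omega> L
  for \<A> :: "('m::{t2_space,second_countable_topology}, real^'n::finite) chart set"
    and b :: "'q::finite \<Rightarrow> 'n"
    and T :: "'m set"
    and \<omega> :: "'m \<Rightarrow> ('q \<Rightarrow> ('m, real^'n) chart \<Rightarrow> real^'q) \<Rightarrow> real"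
    and L :: "(real^'q) \<times> (real^'q^'q) \<Rightarrow> (real, 'k::{finite,linorder} option) vec" +
  assumes atlas: "oriented_foliated_atlas \<A> b"
begin

lemma inj_b: "inj b" and charts_cover: "\<exists>c\<in>\<A>. x \<in> fst c"
  using atlas by (auto simp: oriented_foliated_atlas_def)

lemma chart_facts:
  assumes "c \<in> \<A>"
  shows open_chart: "open (fst c)" and inj_chart: "inj_on (snd c) (fst c)"
proof -
  obtain \<psi> where "open (fst c)" "homeomorphism (fst c) (snd c ` fst c) (snd c) \<psi>"
    using atlas assms unfolding oriented_foliated_atlas_def by blast
  then show "open (fst c)" "inj_on (snd c) (fst c)"
    by (auto simp: homeomorphism_def intro: inj_on_inverseI)
qed

lemma chart_open_map:
  assumes "c \<in> \<A>" "open U"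
  shows "open (snd c ` (U \<inter> fst c))"
proof -
  obtain \<psi> where *: "open (snd c ` fst c)" "homeomorphism (fst c) (snd c ` fst c) (snd c) \<psi>"
    using atlas assms unfolding oriented_foliated_atlas_def by blast
  have "openin (top_of_set (snd c ` fst c)) (snd c ` (fst c \<inter> U))"
    by (rule homeomorphism_imp_open_map[OF *(2)]) (auto simp: assms openin_open_Int)
  then show ?thesis
    using * by (simp add: openin_open_eq Int_commute)
qed

text \<open>Charts are open maps. The point \<open>z\<close> behind each \<open>y\<close> is kept
  because \<open>transition_apply\<close> evaluates transition maps only at coordinates of points of
  the chart.\<close>

lemma eventually_chart:
  assumes "c \<in> \<A>" "x \<in> fst c" "\<forall>\<^sub>F z in nhds x. P z"
  shows "\<forall>\<^sub>F y in nhds (snd c x). \<exists>z\<in>fst c. y = snd c z \<and> P z"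
proof -
  obtain U where "open U" "x \<in> U" "\<forall>z\<in>U. P z"
    using assms(3) by (auto simp: eventually_nhds)
  then show ?thesis
    using chart_open_map[OF assms(1) \<open>open U\<close>] assms(2)
    unfolding eventually_nhds by (intro exI[of _ "snd c ` (U \<inter> fst c)"]) auto
qed

lemma eventually_in_chart: "c \<in> \<A> \<Longrightarrow> x \<in> fst c \<Longrightarrow> \<forall>\<^sub>F z in nhds x. z \<in> fst c"
  using open_chart eventually_nhds_in_open by blast

lemma transition_apply: "c \<in> \<A> \<Longrightarrow> x \<in> fst c \<Longrightarrow> transition c d (snd c x) = snd d x"
  by (simp add: transition_def inj_chart)

section \<open>Full and transverse Jacobians of changes of charts\<close>

definition jac :: "('m, real^'n) chart \<Rightarrow> ('m, real^'n) chart \<Rightarrow> 'm \<Rightarrow> real^'n \<Rightarrow> real^'n" where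
  "jac c d x = frechet_derivative (transition c d) (at (snd c x))"

lemma jac_has_derivative:
  assumes "c \<in> \<A>" "d \<in> \<A>" "x \<in> fst c" "x \<in> fst d"
  shows "(transition c d has_derivative jac c d x) (at (snd c x))"
proof -
  have "smooth_on (snd c ` (fst c \<inter> fst d)) (transition c d)"
    using atlas assms unfolding oriented_foliated_atlas_def by blast
  then have "Ck_on (Suc 0) (snd c ` (fst c \<inter> fst d)) (transition c d)"
    unfolding smooth_on_def by blast
  then have "transition c d differentiable (at (snd c x))"
    using assms by auto
  then show ?thesis
    by (simp add: jac_def frechet_derivative_works)
qed

lemma jac_same:
  assumes "c \<in> \<A>" "x \<in> fst c"
  shows "jac c c x v = v"
proof -
  have "\<forall>\<^sub>F y in nhds (snd c x). transition c c y = y"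
    using eventually_chart[OF assms, of "\<lambda>_. True"] by (auto elim!: eventually_mono simp: transition_apply assms)
  then have "(transition c c has_derivative (\<lambda>v. v)) (at (snd c x))"
    by (rule has_derivative_cong_nhds) simp
  then show ?thesis
    using jac_has_derivative[OF assms(1,1,2,2)] has_derivative_unique by metis
qed

lemma jac_comp:
  assumes "c \<in> \<A>" "d \<in> \<A>" "e \<in> \<A>" "x \<in> fst c" "x \<in> fst d" "x \<in> fst e"
  shows "jac d e x (jac c d x v) = jac c e x v"
proof -
  have "\<forall>\<^sub>F y in nhds (snd c x). transition c e y = (transition d e \<circ> transition c d) y"
    using eventually_chart[OF assms(1,4) eventually_in_chart[OF assms(2,5)]]
    by (auto elim!: eventually_mono simp: transition_apply assms)
  moreover have "(transition d e \<circ> transition c d has_derivative jac d e x \<circ> jac c d x) (at (snd c x))"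
    using jac_has_derivative assms by (intro diff_chain_at) (auto simp: transition_apply)
  ultimately have "(transition c e has_derivative jac d e x \<circ> jac c d x) (at (snd c x))"
    by (rule has_derivative_cong_nhds)
  then show ?thesis
    using jac_has_derivative[OF assms(1,3,4,6)] has_derivative_unique by (metis comp_apply)
qed

text \<open>A linear section of the transverse part; its image, the vectors without leafwise
  components, is one choice of complement to the leafwise directions.\<close>

definition lift :: "real^'q \<Rightarrow> real^'n" where
  "lift u = (\<chi> i. if i \<in> range b then u $ inv b i else 0)"

lemma transverse_lift [simp]: "transverse_part b (lift u) = u"
  by (simp add: transverse_part_def lift_def inj_b vec_eq_iff)

lemma bounded_linear_transverse: "bounded_linear (transverse_part b)"
  by (rule linear_conv_bounded_linear[THEN iffD1], rule linearI)
     (auto simp: transverse_part_def vec_eq_iff)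

lemma bounded_linear_lift: "bounded_linear lift"
  by (rule linear_conv_bounded_linear[THEN iffD1], rule linearI)
     (auto simp: lift_def vec_eq_iff)

text \<open>Derivative of the change of transverse coordinates, i.e. the action of
  \<open>jac\<close> on the quotient by \<open>F\<close>. It does not depend on the lift, as
  \<open>transverse_jac\<close> shows.\<close>

definition tjac :: "('m, real^'n) chart \<Rightarrow> ('m, real^'n) chart \<Rightarrow> 'm \<Rightarrow> real^'q \<Rightarrow> real^'q" where
  "tjac c d x u = transverse_part b (jac c d x (lift u))"

text \<open>Near \<open>snd c x\<close> the transverse part of the transition map is
  \<open>k\<close> applied to the transverse part. Restricted to a transverse slice this identity
  gives the derivative of \<open>k\<close>; differentiated on the whole coordinate space it shows
  that leafwise vectors go to leafwise vectors. Every \<open>k\<close> with this property gets the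
  same derivative.\<close>

lemma tjac_has_derivative:
  assumes "c \<in> \<A>" "d \<in> \<A>" "x \<in> fst c" "x \<in> fst d"
    and k: "\<forall>\<^sub>F z in nhds x. trc d z = k (trc c z)"
  shows "(k has_derivative tjac c d x) (at (trc c x))"
    and "transverse_part b (jac c d x v) = tjac c d x (transverse_part b v)"
proof -
  \<comment> \<open>An affine slice in the transverse directions: a section of the transverse part
    that passes through \<open>snd c x\<close>.\<close>
  define l where "l y = snd c x + lift (y - trc c x)" for y
  have ev: "\<forall>\<^sub>F y in nhds (snd c x). transverse_part b (transition c d y) = k (transverse_part b y)"
    using eventually_chart[OF assms(1,3) k] by (auto elim!: eventually_mono simp: transition_apply assms trc_def)
  have l0: "l (trc c x) = snd c x"
    using bounded_linear_lift by (simp add: l_def linear_simps)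
  have tl: "transverse_part b (l y) = y" for y
    using bounded_linear_transverse by (simp add: l_def linear_simps trc_def)
  have dl: "(l has_derivative lift) (at y)" for y
    unfolding l_def by (auto intro!: derivative_eq_intros bounded_linear.has_derivative[OF bounded_linear_lift])
  have tendl: "filterlim l (nhds (snd c x)) (nhds (trc c x))"
    using has_derivative_continuous[OF dl, of "trc c x"] l0
    by (metis isCont_def tendsto_at_iff_tendsto_nhds)
  have "\<forall>\<^sub>F y in nhds (trc c x). k y = transverse_part b (transition c d (l y))"
    using eventually_compose_filterlim[OF ev tendl] by (auto elim!: eventually_mono simp: tl)
  moreover have "((\<lambda>y. transverse_part b (transition c d (l y))) has_derivative tjac c d x) (at (trc c x))"
    unfolding tjac_def
    using jac_has_derivative[OF assms(1-4)]
    by (intro bounded_linear.has_derivative[OF bounded_linear_transverse] has_derivative_compose[OF dl])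
      (simp add: l0)
  ultimately show k': "(k has_derivative tjac c d x) (at (trc c x))"
    by (rule has_derivative_cong_nhds)
  have "((\<lambda>y. k (transverse_part b y)) has_derivative (\<lambda>v. tjac c d x (transverse_part b v))) (at (snd c x))"
    using has_derivative_compose[OF bounded_linear_imp_has_derivative[OF bounded_linear_transverse], of k]
      k' unfolding trc_def by blast
  then have "((\<lambda>y. transverse_part b (transition c d y)) has_derivative (\<lambda>v. tjac c d x (transverse_part b v))) (at (snd c x))"
    using has_derivative_cong_nhds[OF ev] by simp
  moreover have "((\<lambda>y. transverse_part b (transition c d y)) has_derivative (\<lambda>v. transverse_part b (jac c d x v))) (at (snd c x))"
    by (rule bounded_linear.has_derivative[OF bounded_linear_transverse jac_has_derivative[OF assms(1-4)]])
  ultimately show "transverse_part b (jac c d x v) = tjac c d x (transverse_part b v)"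
    by (rule has_derivative_unique[THEN fun_cong, rotated])
qed

lemma transverse_change_exists:
  assumes "c \<in> \<A>" "d \<in> \<A>" "x \<in> fst c" "x \<in> fst d"
  obtains k where "\<forall>\<^sub>F z in nhds x. trc d z = k (trc c z)"
  using atlas assms unfolding oriented_foliated_atlas_def trc_def by blast

lemma transverse_jac:
  assumes "c \<in> \<A>" "d \<in> \<A>" "x \<in> fst c" "x \<in> fst d"
  shows "transverse_part b (jac c d x v) = tjac c d x (transverse_part b v)"
proof -
  obtain k where "\<forall>\<^sub>F z in nhds x. trc d z = k (trc c z)"
    using transverse_change_exists[OF assms] .
  from tjac_has_derivative(2)[OF assms this] show ?thesis .
qed

lemma linear_tjac:
  assumes "c \<in> \<A>" "d \<in> \<A>" "x \<in> fst c" "x \<in> fst d"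
  shows "linear (tjac c d x)"
proof -
  obtain k where "\<forall>\<^sub>F z in nhds x. trc d z = k (trc c z)"
    using transverse_change_exists[OF assms] .
  from tjac_has_derivative(1)[OF assms this] show ?thesis
    by (rule has_derivative_linear)
qed

lemma tjac_same: "c \<in> \<A> \<Longrightarrow> x \<in> fst c \<Longrightarrow> tjac c c x u = u"
  by (simp add: tjac_def jac_same)

lemma tjac_comp:
  assumes "c \<in> \<A>" "d \<in> \<A>" "e \<in> \<A>" "x \<in> fst c" "x \<in> fst d" "x \<in> fst e"
  shows "tjac d e x (tjac c d x u) = tjac c e x u"
  by (simp add: tjac_def[of c] transverse_jac[symmetric] jac_comp assms)

text \<open>Replaces the image of the tangent space by compatibility under transverse Jacobians, so
  that later arguments stay with normal vectors.\<close>

lemma \<tau>_iff: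
  "w \<in> \<tau> x \<longleftrightarrow> (\<forall>c\<in>\<A>. \<forall>d\<in>\<A>. x \<in> fst c \<longrightarrow> x \<in> fst d \<longrightarrow> w d = tjac c d x (w c)) \<and>
     (\<forall>c. c \<notin> \<A> \<or> x \<notin> fst c \<longrightarrow> w c = 0)" (is "_ \<longleftrightarrow> ?R")
proof
  assume "w \<in> \<tau> x"
  then obtain v where v: "v \<in> tangent_space \<A> x" and w: "w = (\<lambda>c. transverse_part b (v c))"
    by (auto simp: \<tau>_def)
  have "v d = jac c d x (v c)" if "c \<in> \<A>" "d \<in> \<A>" "x \<in> fst c" "x \<in> fst d" for c d
    using v that unfolding tangent_space_def jac_def by blast
  moreover have "w c = 0" if "c \<notin> \<A> \<or> x \<notin> fst c" for c
  proof -
    have "v c = 0"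
      using v that unfolding tangent_space_def by blast
    then show ?thesis
      by (simp add: w linear_0 bounded_linear.linear[OF bounded_linear_transverse])
  qed
  ultimately show ?R
    by (metis transverse_jac w)
next
  assume R: ?R
  obtain c where c: "c \<in> \<A>" "x \<in> fst c"
    using charts_cover by blast
  \<comment> \<open>One component is lifted in the chart \<open>c\<close> and spread by
    \<open>jac\<close>; \<open>jac_comp\<close> makes the family consistent, and another lift would
    change \<open>v\<close> by a leafwise vector only.\<close>
  define v where "v d = (if d \<in> \<A> \<and> x \<in> fst d then jac c d x (lift (w c)) else 0)" for d
  have "v \<in> tangent_space \<A> x"
    unfolding tangent_space_def jac_def[symmetric]
    by (intro CollectI conjI ballI allI impI) (auto simp: v_def jac_comp c)
  moreover have "w = (\<lambda>d. transverse_part b (v d))"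
  proof
    fix d show "w d = transverse_part b (v d)"
    proof (cases "d \<in> \<A> \<and> x \<in> fst d")
      case True
      then have "w d = tjac c d x (w c)"
        using R c by blast
      with True show ?thesis
        by (simp add: v_def tjac_def)
    next
      case False
      then have "w d = 0" "v d = 0"
        using R by (auto simp: v_def simp del: split_paired_All)
      then show ?thesis
        by (simp add: linear_0 bounded_linear.linear[OF bounded_linear_transverse])
    qed
  qed
  ultimately show "w \<in> \<tau> x"
    by (auto simp: \<tau>_def)
qed

section \<open>Normal vectors and linear operations on them\<close>

lemma \<tau>D: "w \<in> \<tau> x \<Longrightarrow> c \<in> \<A> \<Longrightarrow> d \<in> \<A> \<Longrightarrow> x \<in> fst c \<Longrightarrow> x \<in> fst d \<Longrightarrow> tjac c d x (w c) = w d"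
  using \<tau>_iff by metis

lemma \<tau>D0: "w \<in> \<tau> x \<Longrightarrow> c \<notin> \<A> \<or> x \<notin> fst c \<Longrightarrow> w c = 0"
  using \<tau>_iff by blast

lemma \<tau>I:
  assumes "\<And>c d. c \<in> \<A> \<Longrightarrow> d \<in> \<A> \<Longrightarrow> x \<in> fst c \<Longrightarrow> x \<in> fst d \<Longrightarrow> w d = tjac c d x (w c)"
    and "\<And>c. c \<notin> \<A> \<or> x \<notin> fst c \<Longrightarrow> w c = 0"
  shows "w \<in> \<tau> x"
  using assms \<tau>_iff by blast

text \<open>Explicit form of the vector that \<open>\<tau>_of_coords\<close> describes by
  \<open>THE\<close>, when \<open>c\<close> is a chart around \<open>x\<close>.\<close>

definition normal_vec_of :: "'m \<Rightarrow> ('m, real^'n) chart \<Rightarrow> real^'q \<Rightarrow> ('m, 'n, 'q) normal_vec" where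
  "normal_vec_of x c u d = (if d \<in> \<A> \<and> x \<in> fst d then tjac c d x u else 0)"

lemma normal_vec_of_in: "c \<in> \<A> \<Longrightarrow> x \<in> fst c \<Longrightarrow> normal_vec_of x c u \<in> \<tau> x"
  by (rule \<tau>I) (auto simp: normal_vec_of_def tjac_comp)

lemma normal_vec_of_same [simp]: "c \<in> \<A> \<Longrightarrow> x \<in> fst c \<Longrightarrow> normal_vec_of x c u c = u"
  by (simp add: normal_vec_of_def tjac_same)

lemma \<tau>_eqI:
  assumes "w \<in> \<tau> x" "w' \<in> \<tau> x" "c \<in> \<A>" "x \<in> fst c" "w c = w' c"
  shows "w = w'"
proof
  fix d show "w d = w' d"
    using \<tau>D[OF assms(1,3) _ assms(4), of d] \<tau>D[OF assms(2,3) _ assms(4), of d]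
      \<tau>D0[OF assms(1), of d] \<tau>D0[OF assms(2), of d] assms(5) by metis
qed

text \<open>General linear combinations are what the matrix action in
  \<open>positive_density\<close> produces; multiples and two-term sums are the cases indexed by a
  singleton and by \<open>bool\<close>.\<close>

lemma \<tau>_sum:
  assumes "\<And>j. w j \<in> \<tau> x"
  shows "(\<lambda>c. \<Sum>j\<in>J. a j *\<^sub>R w j c) \<in> \<tau> x"
proof (rule \<tau>I)
  fix c d assume *: "c \<in> \<A>" "d \<in> \<A>" "x \<in> fst c" "x \<in> fst d"
  have "tjac c d x (\<Sum>j\<in>J. a j *\<^sub>R w j c) = (\<Sum>j\<in>J. a j *\<^sub>R tjac c d x (w j c))"
    using linear_tjac[OF *] by (simp add: linear_sum linear_scale)
  then show "(\<Sum>j\<in>J. a j *\<^sub>R w j d) = tjac c d x (\<Sum>j\<in>J. a j *\<^sub>R w j c)"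
    by (simp add: \<tau>D[OF assms *])
qed (simp add: \<tau>D0[OF assms])

lemma \<tau>_scale: "w \<in> \<tau> x \<Longrightarrow> (\<lambda>c. a *\<^sub>R w c) \<in> \<tau> x"
  using \<tau>_sum[of "\<lambda>_. w" x "\<lambda>_. a" "{()}"] by simp

lemma \<tau>_add: "w \<in> \<tau> x \<Longrightarrow> w' \<in> \<tau> x \<Longrightarrow> (\<lambda>c. w c + w' c) \<in> \<tau> x"
  using \<tau>_sum[of "\<lambda>i. if i then w else w'" x "\<lambda>_. 1" UNIV] by (simp add: UNIV_bool add.commute)

lemma \<tau>_zero: "(\<lambda>c. 0) \<in> \<tau> x"
  by (rule \<tau>I) (simp_all add: linear_tjac linear_0)

section \<open>Flat sections along leafwise paths\<close>

text \<open>Values of \<open>s\<close> outside \<open>\<tau>\<close> are allowed: with the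
  transverse coordinates of the path as \<open>s\<close> this is the leafwise condition, so gluing
  and reparametrisation are proved once for paths and sections. The form \<open>nhds\<close> with
  the premise \<open>t' \<in> I\<close> treats end points like other times.\<close>

definition locally_const ::
  "(real \<Rightarrow> 'm) \<Rightarrow> (real \<Rightarrow> ('m, 'n, 'q) normal_vec) \<Rightarrow> real set \<Rightarrow> bool" where
  "locally_const \<gamma> s I \<longleftrightarrow> (\<forall>t\<in>I. \<forall>c\<in>\<A>. \<gamma> t \<in> fst c \<longrightarrow> (\<forall>\<^sub>F t' in nhds t. t' \<in> I \<longrightarrow> s t' c = s t c))"

text \<open>These are the parallel sections for the Bott connection of \<open>\<tau>\<close>: along
  a leaf, parallel means locally constant transverse components in foliated charts.\<close>

definition flat :: "(real \<Rightarrow> 'm) \<Rightarrow> (real \<Rightarrow> ('m, 'n, 'q) normal_vec) \<Rightarrow> real set \<Rightarrow> bool" where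
  "flat \<gamma> s I \<longleftrightarrow> (\<forall>t\<in>I. s t \<in> \<tau> (\<gamma> t)) \<and> locally_const \<gamma> s I"

lemma leafwise_path_iff:
  "leafwise_path \<gamma> \<longleftrightarrow> path \<gamma> \<and> locally_const \<gamma> (\<lambda>t c. trc c (\<gamma> t)) {0..1}"
  unfolding leafwise_path_def locally_const_def eventually_at_filter
  by (intro conj_cong refl ball_cong) (auto elim!: eventually_mono)

lemma locally_const_chart:
  assumes "locally_const \<gamma> s I" "{t0..t1} \<subseteq> I" "t0 \<le> t1" "\<gamma> ` {t0..t1} \<subseteq> fst c" "c \<in> \<A>"
  shows "s t1 c = s t0 c"
proof -
  have "\<forall>\<^sub>F t' in at t within {t0..t1}. s t c = s t' c" if "t \<in> {t0..t1}" for t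
  proof -
    have "\<forall>\<^sub>F t' in nhds t. t' \<in> I \<longrightarrow> s t' c = s t c"
      using assms that unfolding locally_const_def by blast
    then show ?thesis
      unfolding eventually_at_filter by eventually_elim (use assms(2) in auto)
  qed
  then have "s t0 c = s t1 c"
    using assms(3) by (intro connected_local_const[of "{t0..t1}" t0 t1 "\<lambda>t. s t c"]) auto
  then show ?thesis ..
qed

text \<open>For \<open>t\<close> strictly on one side of \<open>t1\<close> the other interval is not
  met near \<open>t\<close> and its condition is vacuous; at \<open>t1\<close> both conditions
  contribute.\<close>

lemma locally_const_glue:
  assumes "locally_const \<gamma> s {t0..t1}" "locally_const \<gamma> s {t1..t2}" "t0 \<le> t1" "t1 \<le> t2"
  shows "locally_const \<gamma> s {t0..t2}"
  unfolding locally_const_def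
proof (intro ballI impI)
  fix t c assume *: "t \<in> {t0..t2}" "c \<in> \<A>" "\<gamma> t \<in> fst c"
  have "\<forall>\<^sub>F t' in nhds t. t' \<in> {t0..t1} \<longrightarrow> s t' c = s t c"
  proof (cases "t \<le> t1")
    case True
    then show ?thesis
      using assms(1) * unfolding locally_const_def by auto
  next
    case False
    then show ?thesis
      using eventually_nhds_in_open[of "{t1<..}" t] by (auto elim: eventually_mono)
  qed
  moreover have "\<forall>\<^sub>F t' in nhds t. t' \<in> {t1..t2} \<longrightarrow> s t' c = s t c"
  proof (cases "t1 \<le> t")
    case True
    then show ?thesis
      using assms(2) * unfolding locally_const_def by auto
  next
    case False
    then show ?thesis
      using eventually_nhds_in_open[of "{..<t1}" t] by (auto elim: eventually_mono)
  qed
  ultimately show "\<forall>\<^sub>F t' in nhds t. t' \<in> {t0..t2} \<longrightarrow> s t' c = s t c"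
    by eventually_elim auto
qed

text \<open>Continuity of the reparametrisation pulls back neighbourhoods of \<open>f t\<close>.
  Doubling maps give the halves of a concatenation, the identity gives congruence.\<close>

lemma locally_const_compose:
  assumes "locally_const \<gamma> s I" "\<And>t. isCont f t" "\<And>t. t \<in> J \<Longrightarrow> f t \<in> I"
    and "\<And>t. t \<in> J \<Longrightarrow> \<gamma>' t = \<gamma> (f t)" "\<And>t. t \<in> J \<Longrightarrow> s' t = s (f t)"
  shows "locally_const \<gamma>' s' J"
  unfolding locally_const_def
proof (intro ballI impI)
  fix t c assume *: "t \<in> J" "c \<in> \<A>" "\<gamma>' t \<in> fst c"
  have "filterlim f (nhds (f t)) (nhds t)"
    by (rule tendsto_at_iff_tendsto_nhds[THEN iffD1, OF isContD[OF assms(2)]])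
  moreover have "\<forall>\<^sub>F t' in nhds (f t). t' \<in> I \<longrightarrow> s t' c = s (f t) c"
    using assms(1) assms(3)[OF *(1)] assms(4)[OF *(1)] * unfolding locally_const_def by simp
  ultimately have "\<forall>\<^sub>F t' in nhds t. f t' \<in> I \<longrightarrow> s (f t') c = s (f t) c"
    by (rule eventually_compose_filterlim[rotated])
  then show "\<forall>\<^sub>F t' in nhds t. t' \<in> J \<longrightarrow> s' t' c = s' t c"
    by eventually_elim (use assms(3,5) * in auto)
qed

lemma locally_const_cong:
  "locally_const \<gamma> s I \<Longrightarrow> (\<And>t. t \<in> I \<Longrightarrow> s' t = s t) \<Longrightarrow> locally_const \<gamma> s' I"
  by (rule locally_const_compose[where f = "\<lambda>t. t"]) auto

lemma flat_cong: "flat \<gamma> s I \<Longrightarrow> (\<And>t. t \<in> I \<Longrightarrow> s' t = s t) \<Longrightarrow> flat \<gamma> s' I"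
  using locally_const_cong by (auto simp: flat_def)

lemma flat_glue:
  assumes "flat \<gamma> s {t0..t1}" "flat \<gamma> s' {t1..t2}" "s t1 = s' t1" "t0 \<le> t1" "t1 \<le> t2"
  shows "flat \<gamma> (\<lambda>t. if t \<le> t1 then s t else s' t) {t0..t2}"
proof -
  let ?s = "\<lambda>t. if t \<le> t1 then s t else s' t"
  have "flat \<gamma> ?s {t0..t1}"
    by (rule flat_cong[OF assms(1)]) simp
  moreover have "flat \<gamma> ?s {t1..t2}"
    by (rule flat_cong[OF assms(2)]) (use assms(3) in auto)
  ultimately have "locally_const \<gamma> ?s {t0..t2}" "\<forall>t\<in>{t0..t1} \<union> {t1..t2}. ?s t \<in> \<tau> (\<gamma> t)"
    using locally_const_glue[OF _ _ assms(4,5)] unfolding flat_def by blast+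
  moreover have "{t0..t1} \<union> {t1..t2} = {t0..t2}"
    using assms by auto
  ultimately show ?thesis
    unfolding flat_def by metis
qed

section \<open>Flat sections: existence and uniqueness along a path\<close>

lemma leafwise_pathD: "leafwise_path \<gamma> \<Longrightarrow> path \<gamma>" "leafwise_path \<gamma> \<Longrightarrow> locally_const \<gamma> (\<lambda>t c. trc c (\<gamma> t)) {0..1}"
  by (auto simp: leafwise_path_iff)

lemma trc_const_on_plaque:
  assumes "leafwise_path \<gamma>" "0 \<le> t0" "t0 \<le> t1" "t1 \<le> 1" "\<gamma> ` {t0..t1} \<subseteq> fst c" "c \<in> \<A>"
  shows "trc c (\<gamma> t1) = trc c (\<gamma> t0)"
  using locally_const_chart[OF leafwise_pathD(2)[OF assms(1)] _ assms(3,5,6)] assms by auto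

lemma path_tendsto:
  assumes "path \<gamma>" "t \<in> {0..1}" "\<forall>\<^sub>F z in nhds (\<gamma> t). P z"
  shows "\<forall>\<^sub>F t' in nhds t. t' \<in> {0..1} \<longrightarrow> P (\<gamma> t')"
proof -
  have "(\<gamma> \<longlongrightarrow> \<gamma> t) (at t within {0..1})"
    using assms by (auto simp: path_def continuous_on_def)
  then have "\<forall>\<^sub>F t' in at t within {0..1}. P (\<gamma> t')"
    using eventually_compose_filterlim assms(3) by blast
  then have "\<forall>\<^sub>F t' in nhds t. t' \<noteq> t \<longrightarrow> t' \<in> {0..1} \<longrightarrow> P (\<gamma> t')"
    by (simp add: eventually_at_filter)
  then show ?thesis
    by eventually_elim (use assms(3) in \<open>auto dest: eventually_nhds_x_imp_x\<close>)
qed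

text \<open>Near \<open>\<gamma> t\<close> a single function \<open>k\<close> describes the
  transverse change, and \<open>tjac\<close> at a point of the path is the derivative of
  \<open>k\<close> at its transverse coordinate, which does not move along a leafwise path.\<close>

lemma tjac_locally_const:
  assumes "c \<in> \<A>" "d \<in> \<A>" "leafwise_path \<gamma>" "t \<in> {0..1}" "\<gamma> t \<in> fst c" "\<gamma> t \<in> fst d"
  shows "\<forall>\<^sub>F t' in nhds t. t' \<in> {0..1} \<longrightarrow> \<gamma> t' \<in> fst c \<inter> fst d \<and> tjac c d (\<gamma> t') = tjac c d (\<gamma> t)"
proof -
  obtain k where "\<forall>\<^sub>F z in nhds (\<gamma> t). trc d z = k (trc c z)"
    using transverse_change_exists[OF assms(1,2,5,6)] .
  then have "\<forall>\<^sub>F x in nhds (\<gamma> t). \<forall>\<^sub>F z in nhds x. trc d z = k (trc c z)"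
    by (simp add: eventually_eventually)
  moreover have "\<forall>\<^sub>F x in nhds (\<gamma> t). x \<in> fst c \<inter> fst d"
    using assms by (intro eventually_nhds_in_open open_Int open_chart) auto
  ultimately have "\<forall>\<^sub>F x in nhds (\<gamma> t). x \<in> fst c \<inter> fst d \<and> (k has_derivative tjac c d x) (at (trc c x))"
    by eventually_elim (use assms(1,2) tjac_has_derivative(1) in auto)
  note x = eventually_nhds_x_imp_x[OF this] path_tendsto[OF leafwise_pathD(1)[OF assms(3)] assms(4) this]
  have "\<forall>\<^sub>F t' in nhds t. t' \<in> {0..1} \<longrightarrow> trc c (\<gamma> t') = trc c (\<gamma> t)"
    using leafwise_pathD(2)[OF assms(3)] assms unfolding locally_const_def by blast
  with x(2) show ?thesis
    by eventually_elim (use x(1) has_derivative_unique[of k _ "trc c (\<gamma> t)"] in auto)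
qed

text \<open>Keep the component in \<open>e\<close> fixed; by \<open>tjac_locally_const\<close> the
  components in all other charts are then locally constant as well. The time \<open>p\<close> is
  free so that either end can carry the prescribed value.\<close>

lemma flat_in_chart:
  assumes "leafwise_path \<gamma>" "e \<in> \<A>" "I \<subseteq> {0..1}" "\<gamma> ` I \<subseteq> fst e" "p \<in> I" "w \<in> \<tau> (\<gamma> p)"
  obtains s where "flat \<gamma> s I" "s p = w"
proof
  define s where "s t = normal_vec_of (\<gamma> t) e (w e)" for t
  have "locally_const \<gamma> s I"
    unfolding locally_const_def
  proof (intro ballI impI)
    fix t c assume *: "t \<in> I" "c \<in> \<A>" "\<gamma> t \<in> fst c"
    then have "\<gamma> t \<in> fst e" "t \<in> {0..1}"
      using assms(3,4) by blast+
    from tjac_locally_const[OF assms(2) *(2) assms(1) this(2,1) *(3)]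
    show "\<forall>\<^sub>F t' in nhds t. t' \<in> I \<longrightarrow> s t' c = s t c"
      by eventually_elim (use * assms(3) in \<open>auto simp: s_def normal_vec_of_def\<close>)
  qed
  moreover have "s t \<in> \<tau> (\<gamma> t)" if "t \<in> I" for t
    using that assms unfolding s_def by (intro normal_vec_of_in) auto
  ultimately show "flat \<gamma> s I"
    by (simp add: flat_def)
  then have "s p \<in> \<tau> (\<gamma> p)"
    using assms by (auto simp: flat_def)
  then show "s p = w"
    using assms by (intro \<tau>_eqI[of _ "\<gamma> p" _ e]) (auto simp: s_def)
qed

text \<open>Bisection stands in for choosing a finite subdivision of the path subordinate to the
  charts. Existence and uniqueness of flat sections and existence of chains all follow this
  pattern.\<close>

lemma leafwise_path_bisect:
  assumes \<gamma>: "leafwise_path \<gamma>"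
    and trans: "\<And>a b c. 0 \<le> a \<Longrightarrow> a \<le> b \<Longrightarrow> b \<le> c \<Longrightarrow> c \<le> 1 \<Longrightarrow> P a b \<Longrightarrow> P b c \<Longrightarrow> P a c"
    and loc: "\<And>a b e. 0 \<le> a \<Longrightarrow> a \<le> b \<Longrightarrow> b \<le> 1 \<Longrightarrow> e \<in> \<A> \<Longrightarrow> \<gamma> ` {a..b} \<subseteq> fst e \<Longrightarrow> P a b"
  shows "P (0::real) 1"
proof -
  \<comment> \<open>The intervals considered by \<open>Bolzano\<close> may leave
    \<open>{0..1}\<close>, so the bounds move into the predicate.\<close>
  have "0 \<le> (0::real) \<and> (1::real) \<le> 1 \<longrightarrow> P 0 1"
  proof (rule Bolzano[where P = "\<lambda>a b. 0 \<le> a \<and> b \<le> 1 \<longrightarrow> P a b"])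
    fix t :: real assume t: "0 \<le> t" "t \<le> 1"
    obtain e where e: "e \<in> \<A>" "\<gamma> t \<in> fst e"
      using charts_cover by blast
    have "\<forall>\<^sub>F t' in nhds t. t' \<in> {0..1} \<longrightarrow> \<gamma> t' \<in> fst e"
      using t e by (intro path_tendsto leafwise_pathD(1)[OF \<gamma>] eventually_in_chart) auto
    \<comment> \<open>Here \<open>\<delta>\<close> is a radius and hides the modular
      function.\<close>
    then obtain \<delta> where \<delta>: "\<delta> > 0" "\<And>t'. dist t' t < \<delta> \<Longrightarrow> t' \<in> {0..1} \<Longrightarrow> \<gamma> t' \<in> fst e"
      unfolding eventually_nhds_metric by blast
    show "\<exists>\<delta>>0. \<forall>a b. a \<le> t \<and> t \<le> b \<and> b - a < \<delta> \<longrightarrow> 0 \<le> a \<and> b \<le> 1 \<longrightarrow> P a b"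
    proof (intro exI[of _ \<delta>] conjI allI impI)
      fix a b assume ab: "a \<le> t \<and> t \<le> b \<and> b - a < \<delta>" "0 \<le> a \<and> b \<le> 1"
      then have "\<gamma> t' \<in> fst e" if "t' \<in> {a..b}" for t'
        using that by (intro \<delta>) (auto simp: dist_real_def)
      then show "P a b"
        using ab e by (intro loc) auto
    qed (rule \<delta>)
  qed (auto intro: trans)
  then show ?thesis by simp
qed

text \<open>Existence on plaques is \<open>flat_in_chart\<close>, and solutions glue. Prescribing
  the end value as well yields surjectivity of the action without reversing paths.\<close>

lemma flat_exists:
  assumes "leafwise_path \<gamma>"
  shows "w \<in> \<tau> (\<gamma> 0) \<Longrightarrow> \<exists>s. flat \<gamma> s {0..1} \<and> s 0 = w"
    and "w \<in> \<tau> (\<gamma> 1) \<Longrightarrow> \<exists>s. flat \<gamma> s {0..1} \<and> s 1 = w"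
proof -
  have "(\<forall>w\<in>\<tau> (\<gamma> 0). \<exists>s. flat \<gamma> s {0..1} \<and> s 0 = w) \<and> (\<forall>w\<in>\<tau> (\<gamma> 1). \<exists>s. flat \<gamma> s {0..1} \<and> s 1 = w)"
  proof (rule leafwise_path_bisect[OF assms, where P =
        "\<lambda>a b. (\<forall>w\<in>\<tau> (\<gamma> a). \<exists>s. flat \<gamma> s {a..b} \<and> s a = w) \<and> (\<forall>w\<in>\<tau> (\<gamma> b). \<exists>s. flat \<gamma> s {a..b} \<and> s b = w)"])
    fix a b e assume *: "0 \<le> a" "a \<le> b" "b \<le> 1" "e \<in> \<A>" "\<gamma> ` {a..b} \<subseteq> fst e"
    show "(\<forall>w\<in>\<tau> (\<gamma> a). \<exists>s. flat \<gamma> s {a..b} \<and> s a = w) \<and> (\<forall>w\<in>\<tau> (\<gamma> b). \<exists>s. flat \<gamma> s {a..b} \<and> s b = w)"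
    proof (intro conjI ballI)
      show "\<exists>s. flat \<gamma> s {a..b} \<and> s a = w" if "w \<in> \<tau> (\<gamma> a)" for w
        using flat_in_chart[OF assms *(4) _ *(5) _ that] * by (metis atLeastatMost_subset_iff atLeastAtMost_iff order_refl)
      show "\<exists>s. flat \<gamma> s {a..b} \<and> s b = w" if "w \<in> \<tau> (\<gamma> b)" for w
        using flat_in_chart[OF assms *(4) _ *(5) _ that] * by (metis atLeastatMost_subset_iff atLeastAtMost_iff order_refl)
    qed
  next
    fix a b c :: real
    assume ab: "(\<forall>w\<in>\<tau> (\<gamma> a). \<exists>s. flat \<gamma> s {a..b} \<and> s a = w) \<and> (\<forall>w\<in>\<tau> (\<gamma> b). \<exists>s. flat \<gamma> s {a..b} \<and> s b = w)"
      and bc: "(\<forall>w\<in>\<tau> (\<gamma> b). \<exists>s. flat \<gamma> s {b..c} \<and> s b = w) \<and> (\<forall>w\<in>\<tau> (\<gamma> c). \<exists>s. flat \<gamma> s {b..c} \<and> s c = w)"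
      and le: "a \<le> b" "b \<le> c"
    show "(\<forall>w\<in>\<tau> (\<gamma> a). \<exists>s. flat \<gamma> s {a..c} \<and> s a = w) \<and> (\<forall>w\<in>\<tau> (\<gamma> c). \<exists>s. flat \<gamma> s {a..c} \<and> s c = w)"
    proof (intro conjI ballI)
      fix w assume "w \<in> \<tau> (\<gamma> a)"
      then obtain s where s: "flat \<gamma> s {a..b}" "s a = w"
        using ab by blast
      then have "s b \<in> \<tau> (\<gamma> b)"
        using le by (auto simp: flat_def)
      then obtain s' where "flat \<gamma> s' {b..c}" "s' b = s b"
        using bc by blast
      with flat_glue[OF s(1)] s le show "\<exists>s. flat \<gamma> s {a..c} \<and> s a = w"
        by (intro exI[of _ "\<lambda>t. if t \<le> b then s t else s' t"]) auto
    next
      fix w assume "w \<in> \<tau> (\<gamma> c)"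
      then obtain s' where s': "flat \<gamma> s' {b..c}" "s' c = w"
        using bc by blast
      then have "s' b \<in> \<tau> (\<gamma> b)"
        using le by (auto simp: flat_def)
      then obtain s where "flat \<gamma> s {a..b}" "s b = s' b"
        using ab by blast
      with flat_glue[OF _ s'(1)] s' le show "\<exists>s. flat \<gamma> s {a..c} \<and> s c = w"
        by (intro exI[of _ "\<lambda>t. if t \<le> b then s t else s' t"]) auto
    qed
  qed
  then show "w \<in> \<tau> (\<gamma> 0) \<Longrightarrow> \<exists>s. flat \<gamma> s {0..1} \<and> s 0 = w" "w \<in> \<tau> (\<gamma> 1) \<Longrightarrow> \<exists>s. flat \<gamma> s {0..1} \<and> s 1 = w"
    by simp_all
qed

text \<open>On a plaque both sections have constant components in one chart, and one component
  determines a vector. The equivalence is transitive in the times, as the bisection requires; read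
  backwards it gives injectivity of the action.\<close>

lemma flat_unique:
  assumes "leafwise_path \<gamma>" and s: "flat \<gamma> s {0..1}" and s': "flat \<gamma> s' {0..1}"
  shows "s 0 = s' 0 \<longleftrightarrow> s 1 = s' 1"
proof (rule leafwise_path_bisect[OF assms(1), where P = "\<lambda>a b. s a = s' a \<longleftrightarrow> s b = s' b"])
  fix a b e assume *: "0 \<le> a" "a \<le> b" "b \<le> 1" "e \<in> \<A>" "\<gamma> ` {a..b} \<subseteq> fst e"
  have "s b e = s a e" "s' b e = s' a e"
    using s s' * locally_const_chart[OF _ _ *(2,5,4), of s "{0..1}"]
      locally_const_chart[OF _ _ *(2,5,4), of s' "{0..1}"] by (simp_all add: flat_def)
  moreover have "s a \<in> \<tau> (\<gamma> a)" "s b \<in> \<tau> (\<gamma> b)" "s' a \<in> \<tau> (\<gamma> a)" "s' b \<in> \<tau> (\<gamma> b)" "\<gamma> a \<in> fst e" "\<gamma> b \<in> fst e"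
    using * s s' by (auto simp: flat_def)
  ultimately show "s a = s' a \<longleftrightarrow> s b = s' b"
    using \<tau>_eqI[OF _ _ *(4)] by metis
qed auto

text \<open>Induction on the chain: a plaque changes neither the transverse coordinate nor the
  component of a flat section, and a change of chart composes with \<open>tjac\<close>. The equation
  for \<open>h (trc c (\<gamma> 0))\<close> belongs to the induction because it says where
  \<open>k\<close> has to be differentiated.\<close>

lemma holonomy_chain_flat:
  assumes "holonomy_chain \<gamma> c d t h" "leafwise_path \<gamma>"
  shows "c \<in> \<A> \<and> \<gamma> 0 \<in> fst c \<and> d \<in> \<A> \<and> \<gamma> t \<in> fst d \<and> t \<in> {0..1} \<and> h (trc c (\<gamma> 0)) = trc d (\<gamma> t) \<and>
    (\<exists>D. (h has_derivative D) (at (trc c (\<gamma> 0))) \<and> (\<forall>s. flat \<gamma> s {0..1} \<longrightarrow> s t d = D (s 0 c)))"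
  using assms
proof (induction rule: holonomy_chain.induct)
  case start
  then show ?case
    by (auto intro!: exI[of _ "\<lambda>v. v"])
next
  case (plaque d t h t')
  then obtain D where D: "(h has_derivative D) (at (trc c (\<gamma> 0)))" "\<forall>s. flat \<gamma> s {0..1} \<longrightarrow> s t d = D (s 0 c)"
    by blast
  moreover have "s t' d = s t d" if "flat \<gamma> s {0..1}" for s
    using locally_const_chart[OF _ _ plaque.hyps(2,4), of s "{0..1}"] that plaque by (auto simp: flat_def)
  moreover have "trc d (\<gamma> t') = trc d (\<gamma> t)"
    using plaque by (intro trc_const_on_plaque) auto
  ultimately show ?case
    using plaque by auto
next
  case (change d t h e k)
  then obtain D where D: "(h has_derivative D) (at (trc c (\<gamma> 0)))" "\<forall>s. flat \<gamma> s {0..1} \<longrightarrow> s t d = D (s 0 c)"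
    by blast
  have *: "d \<in> \<A>" "\<gamma> t \<in> fst d" "h (trc c (\<gamma> 0)) = trc d (\<gamma> t)"
    using change by auto
  have "(k has_derivative tjac d e (\<gamma> t)) (at (h (trc c (\<gamma> 0))))"
    unfolding * using change * by (intro tjac_has_derivative(1)) auto
  then have "(k \<circ> h has_derivative tjac d e (\<gamma> t) \<circ> D) (at (trc c (\<gamma> 0)))"
    using D by (intro diff_chain_at) auto
  moreover have "s t e = (tjac d e (\<gamma> t) \<circ> D) (s 0 c)" if "flat \<gamma> s {0..1}" for s
  proof -
    have "s t \<in> \<tau> (\<gamma> t)"
      using that change by (auto simp: flat_def)
    then show ?thesis
      using \<tau>D[of "s t" "\<gamma> t" d e] * change D(2) that by simp
  qed
  moreover have "trc e (\<gamma> t) = k (trc d (\<gamma> t))"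
    using change.hyps eventually_nhds_x_imp_x by fastforce
  ultimately show ?case
    unfolding o_apply using change * by (auto simp: o_def intro!: exI[of _ "tjac d e (\<gamma> t) \<circ> D"])
qed

lemma has_holonomy_flat:
  assumes "has_holonomy \<gamma> c d h" "leafwise_path \<gamma>"
  shows "c \<in> \<A>" "\<gamma> 0 \<in> fst c" "d \<in> \<A>" "\<gamma> 1 \<in> fst d" "(h has_derivative frechet_derivative h (at (trc c (\<gamma> 0)))) (at (trc c (\<gamma> 0)))"
    "flat \<gamma> s {0..1} \<Longrightarrow> s 1 d = frechet_derivative h (at (trc c (\<gamma> 0))) (s 0 c)"
proof -
  obtain h' where h': "holonomy_chain \<gamma> c d 1 h'" "\<forall>\<^sub>F y in nhds (trc c (\<gamma> 0)). h y = h' y"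
    using assms by (auto simp: has_holonomy_def)
  note hf = holonomy_chain_flat[OF h'(1) assms(2)]
  then obtain D where D: "(h' has_derivative D) (at (trc c (\<gamma> 0)))" "\<And>s. flat \<gamma> s {0..1} \<longrightarrow> s 1 d = D (s 0 c)"
    by blast
  have hD: "(h has_derivative D) (at (trc c (\<gamma> 0)))"
    using has_derivative_cong_nhds[OF h'(2) D(1)] .
  have "frechet_derivative h (at (trc c (\<gamma> 0))) = D"
    using frechet_derivative_at[OF hD] by simp
  then show "c \<in> \<A>" "\<gamma> 0 \<in> fst c" "d \<in> \<A>" "\<gamma> 1 \<in> fst d" "(h has_derivative frechet_derivative h (at (trc c (\<gamma> 0)))) (at (trc c (\<gamma> 0)))"
    "flat \<gamma> s {0..1} \<Longrightarrow> s 1 d = frechet_derivative h (at (trc c (\<gamma> 0))) (s 0 c)"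
    using hf D hD by auto
qed

text \<open>Without a holonomy map the condition in the \<open>THE\<close> of \<open>hol_act\<close>
  would be vacuous. As chains start at time 0, the relation composed along the path is the
  implication from a chain up to \<open>s\<close> to a chain up to \<open>t\<close>.\<close>

lemma has_holonomy_exists:
  assumes "leafwise_path \<gamma>"
  obtains c d h where "has_holonomy \<gamma> c d h"
proof -
  obtain c where c: "c \<in> \<A>" "\<gamma> 0 \<in> fst c"
    using charts_cover by blast
  have "(\<exists>d h. holonomy_chain \<gamma> c d 0 h) \<longrightarrow> (\<exists>d h. holonomy_chain \<gamma> c d 1 h)"
  proof (rule leafwise_path_bisect[OF assms, where P =
        "\<lambda>s t. (\<exists>d h. holonomy_chain \<gamma> c d s h) \<longrightarrow> (\<exists>d h. holonomy_chain \<gamma> c d t h)"])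
    fix a b e assume *: "0 \<le> a" "a \<le> b" "b \<le> 1" "e \<in> \<A>" "\<gamma> ` {a..b} \<subseteq> fst e"
    show "(\<exists>d h. holonomy_chain \<gamma> c d a h) \<longrightarrow> (\<exists>d h. holonomy_chain \<gamma> c d b h)"
    proof (intro impI, elim exE)
      fix d h assume h: "holonomy_chain \<gamma> c d a h"
      have e: "\<gamma> a \<in> fst e" "\<gamma> a \<in> fst d" "d \<in> \<A>"
        using * holonomy_chain_flat[OF h assms] by auto
      obtain k where "\<forall>\<^sub>F z in nhds (\<gamma> a). trc e z = k (trc d z)"
        using transverse_change_exists[OF e(3) *(4) e(2,1)] .
      then have "holonomy_chain \<gamma> c e a (k \<circ> h)"
        by (rule holonomy_chain.change[OF h *(4) e(1)])
      then show "\<exists>d h. holonomy_chain \<gamma> c d b h"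
        using holonomy_chain.plaque * by blast
    qed
  qed auto
  moreover have "holonomy_chain \<gamma> c c 0 (\<lambda>y. y)"
    by (rule holonomy_chain.start) (use c in auto)
  ultimately obtain d h where "holonomy_chain \<gamma> c d 1 h"
    by blast
  then have "has_holonomy \<gamma> c d h"
    unfolding has_holonomy_def by (auto intro!: exI[of _ h])
  then show ?thesis
    by (rule that)
qed

section \<open>The holonomy action\<close>

lemma flat_ends: "flat \<gamma> s {0..1} \<Longrightarrow> s 0 \<in> \<tau> (\<gamma> 0)" "flat \<gamma> s {0..1} \<Longrightarrow> s 1 \<in> \<tau> (\<gamma> 1)"
  by (auto simp: flat_def)

lemma holonomy_equiv_refl: "leafwise_path \<gamma> \<Longrightarrow> holonomy_equiv \<gamma> \<gamma>"
  by (simp add: holonomy_equiv_def)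

lemma holonomy_equivD:
  assumes "holonomy_equiv \<gamma> \<gamma>'"
  shows "leafwise_path \<gamma>" "leafwise_path \<gamma>'" "pathstart \<gamma> = pathstart \<gamma>'" "pathfinish \<gamma> = pathfinish \<gamma>'"
    "has_holonomy \<gamma> c d h \<longleftrightarrow> has_holonomy \<gamma>' c d h"
  using assms unfolding holonomy_equiv_def by blast+

section \<open>Holonomy classes, their representatives and their action\<close>

lemma src_eqI:
  assumes "g \<noteq> {}" "\<And>\<gamma>. \<gamma> \<in> g \<Longrightarrow> pathstart \<gamma> = x"
  shows "src g = x"
  unfolding src_def by (rule assms(2)) (simp add: some_in_eq assms(1))

lemma rng_eqI:
  assumes "g \<noteq> {}" "\<And>\<gamma>. \<gamma> \<in> g \<Longrightarrow> pathfinish \<gamma> = x"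
  shows "rng g = x"
  unfolding rng_def by (rule assms(2)) (simp add: some_in_eq assms(1))

lemma G_obtain_path:
  assumes "g \<in> G"
  obtains \<gamma> where "\<gamma> \<in> g" "leafwise_path \<gamma>" "\<forall>\<gamma>'\<in>g. holonomy_equiv \<gamma> \<gamma>'"
    "pathstart \<gamma> = src g" "pathfinish \<gamma> = rng g"
proof -
  obtain \<gamma> where \<gamma>: "leafwise_path \<gamma>" and g: "g = {\<gamma>'. holonomy_equiv \<gamma> \<gamma>'}"
    using assms by (auto simp: G_def hol_class_def)
  then have ne: "\<gamma> \<in> g"
    by (simp add: holonomy_equiv_refl)
  have eq: "holonomy_equiv \<gamma> \<gamma>'" if "\<gamma>' \<in> g" for \<gamma>'
    using g that by simp
  show ?thesis
  proof (rule that[OF ne \<gamma>])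
    show "\<forall>\<gamma>'\<in>g. holonomy_equiv \<gamma> \<gamma>'"
      using eq by blast
    show "pathstart \<gamma> = src g" "pathfinish \<gamma> = rng g"
      using ne holonomy_equivD(3,4)[OF eq] by (metis src_eqI rng_eqI empty_iff)+
  qed
qed

text \<open>The elements of \<open>comp g g'\<close> are only holonomy equivalent to concatenated paths, and flat
  sections are available on the latter.\<close>

definition carries :: "(real \<Rightarrow> 'm) \<Rightarrow> ('m, 'n, 'q) normal_vec \<Rightarrow> ('m, 'n, 'q) normal_vec \<Rightarrow> bool" where
  "carries \<gamma> w w' \<longleftrightarrow> (\<exists>\<gamma>' s. holonomy_equiv \<gamma>' \<gamma> \<and> flat \<gamma>' s {0..1} \<and> s 0 = w \<and> s 1 = w')"

lemma carriesD:
  assumes "carries \<gamma> w w'"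
  shows "w' \<in> \<tau> (pathfinish \<gamma>)" "leafwise_path \<gamma>"
    "has_holonomy \<gamma> c d h \<Longrightarrow> d \<in> \<A> \<and> pathfinish \<gamma> \<in> fst d \<and>
      w' d = frechet_derivative h (at (trc c (pathstart \<gamma>))) (w c)"
proof -
  obtain \<gamma>' s where *: "holonomy_equiv \<gamma>' \<gamma>" and s: "flat \<gamma>' s {0..1}" "s 0 = w" "s 1 = w'"
    using assms by (auto simp: carries_def)
  note eq = holonomy_equivD[OF *]
  show "leafwise_path \<gamma>" by (rule eq)
  show "w' \<in> \<tau> (pathfinish \<gamma>)"
    using flat_ends(2)[OF s(1)] s(3) eq(4) by (simp add: pathfinish_def)
  show "d \<in> \<A> \<and> pathfinish \<gamma> \<in> fst d \<and> w' d = frechet_derivative h (at (trc c (pathstart \<gamma>))) (w c)"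
    if "has_holonomy \<gamma> c d h"
  proof -
    have "has_holonomy \<gamma>' c d h"
      using that eq(5) by simp
    note h = has_holonomy_flat[OF this eq(1)]
    show ?thesis
      using h(3,4) h(6)[OF s(1)] eq(3,4) s(2,3) by (simp add: pathstart_def pathfinish_def)
  qed
qed

text \<open>Uniqueness uses one holonomy map of one path: it fixes the component in the chart
  \<open>d\<close>, and one component determines a normal vector. The premises speak of any nonempty
  set of paths so that composites are covered directly.\<close>

lemma hol_act_eqI:
  assumes "g \<noteq> {}" "\<And>\<gamma>. \<gamma> \<in> g \<Longrightarrow> pathstart \<gamma> = x" "\<And>\<gamma>. \<gamma> \<in> g \<Longrightarrow> carries \<gamma> w w'"
  shows "hol_act g w = w'"
proof -
  have src: "src g = x"
    by (rule src_eqI[OF assms(1,2)])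
  define \<gamma> where "\<gamma> = (SOME \<gamma>. \<gamma> \<in> g)"
  then have \<gamma>: "\<gamma> \<in> g" "rng g = pathfinish \<gamma>"
    using assms(1) by (auto simp: rng_def some_in_eq)
  obtain c d h where h: "has_holonomy \<gamma> c d h"
    by (rule has_holonomy_exists[OF carriesD(2)[OF assms(3)[OF \<gamma>(1)]]])
  note d = carriesD(3)[OF assms(3)[OF \<gamma>(1)] h]
  show ?thesis
    unfolding hol_act_def
  proof (rule the_equality)
    show "w' \<in> \<tau> (rng g) \<and> (\<forall>\<gamma>\<in>g. \<forall>c d h. has_holonomy \<gamma> c d h \<longrightarrow>
        w' d = frechet_derivative h (at (trc c (src g))) (w c))"
      using carriesD(1)[OF assms(3)[OF \<gamma>(1)]] carriesD(3)[OF assms(3)] \<gamma>(2) src assms(2) by simp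
  next
    fix v assume v: "v \<in> \<tau> (rng g) \<and> (\<forall>\<gamma>\<in>g. \<forall>c d h. has_holonomy \<gamma> c d h \<longrightarrow>
        v d = frechet_derivative h (at (trc c (src g))) (w c))"
    then have "v d = frechet_derivative h (at (trc c (src g))) (w c)"
      using \<gamma>(1) h by blast
    then have "v d = w' d"
      using d src assms(2)[OF \<gamma>(1)] by simp
    then show "v = w'"
      using \<tau>_eqI v d \<gamma>(2) carriesD(1)[OF assms(3)[OF \<gamma>(1)]] by metis
  qed
qed

lemma hol_act_flat:
  assumes "g \<in> G" "\<gamma> \<in> g" "flat \<gamma> s {0..1}"
  shows "hol_act g (s 0) = s 1"
proof -
  obtain \<gamma>0 where \<gamma>0: "\<gamma>0 \<in> g" "leafwise_path \<gamma>0" "\<forall>\<gamma>'\<in>g. holonomy_equiv \<gamma>0 \<gamma>'"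
    "pathstart \<gamma>0 = src g" "pathfinish \<gamma>0 = rng g"
    using G_obtain_path[OF assms(1)] .
  have "holonomy_equiv \<gamma> \<gamma>'" if "\<gamma>' \<in> g" for \<gamma>'
    using \<gamma>0(3)[rule_format, OF that] \<gamma>0(3)[rule_format, OF assms(2)] unfolding holonomy_equiv_def by simp
  then have "carries \<gamma>' (s 0) (s 1)" if "\<gamma>' \<in> g" for \<gamma>'
    using assms(3) that unfolding carries_def by blast
  moreover have "pathstart \<gamma>' = src g" if "\<gamma>' \<in> g" for \<gamma>'
    using holonomy_equivD(3)[OF \<gamma>0(3)[rule_format, OF that]] \<gamma>0(4) by simp
  ultimately show ?thesis
    using \<gamma>0(1) by (intro hol_act_eqI) auto
qed

text \<open>Flat sections with prescribed initial value show that the images lie in the target,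
  uniqueness read backwards gives injectivity, and prescribed end values give surjectivity.\<close>

lemma hol_act_bij:
  assumes "g \<in> G"
  shows "bij_betw (hol_act g) (\<tau> (src g)) (\<tau> (rng g))"
proof -
  obtain \<gamma> where \<gamma>: "\<gamma> \<in> g" "leafwise_path \<gamma>" "\<forall>\<gamma>'\<in>g. holonomy_equiv \<gamma> \<gamma>'"
    "pathstart \<gamma> = src g" "pathfinish \<gamma> = rng g"
    using G_obtain_path[OF assms] .
  have ends: "\<gamma> 0 = src g" "\<gamma> 1 = rng g"
    using \<gamma>(4,5) by (auto simp: pathstart_def pathfinish_def)
  note fl = hol_act_flat[OF assms \<gamma>(1)]
  have ex: "\<exists>s. flat \<gamma> s {0..1} \<and> s 0 = w" if "w \<in> \<tau> (src g)" for w
    using flat_exists(1)[OF \<gamma>(2)] that ends by simp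
  have "inj_on (hol_act g) (\<tau> (src g))"
  proof (rule inj_onI)
    fix w w' assume w: "w \<in> \<tau> (src g)" "w' \<in> \<tau> (src g)" and eq: "hol_act g w = hol_act g w'"
    obtain s s' where "flat \<gamma> s {0..1}" "s 0 = w" "flat \<gamma> s' {0..1}" "s' 0 = w'"
      using ex w by metis
    then show "w = w'"
      using fl flat_unique[OF \<gamma>(2)] eq by metis
  qed
  moreover have "hol_act g w \<in> \<tau> (rng g)" if w: "w \<in> \<tau> (src g)" for w
  proof -
    obtain s where s: "flat \<gamma> s {0..1}" "s 0 = w"
      using ex[OF w] by blast
    then have "s 1 \<in> \<tau> (rng g)"
      using flat_ends(2)[OF s(1)] ends by simp
    then show ?thesis
      using fl[OF s(1)] s(2) by simp
  qed
  moreover have "w \<in> hol_act g ` \<tau> (src g)" if w: "w \<in> \<tau> (rng g)" for w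
  proof -
    obtain s where s: "flat \<gamma> s {0..1}" "s 1 = w"
      using flat_exists(2)[OF \<gamma>(2)] w ends by metis
    then have "s 0 \<in> \<tau> (src g)"
      using flat_ends(1)[OF s(1)] ends by simp
    then show ?thesis
      using fl[OF s(1)] s(2) by (metis imageI)
  qed
  ultimately show ?thesis
    unfolding bij_betw_def by blast
qed

lemma hol_act_in: "g \<in> G \<Longrightarrow> w \<in> \<tau> (src g) \<Longrightarrow> hol_act g w \<in> \<tau> (rng g)"
  using hol_act_bij bij_betwE by blast

text \<open>Read in charts at the two ends, the action is the derivative of a single holonomy map,
  hence linear.\<close>

lemma hol_act_sum:
  assumes "g \<in> G" "\<And>j. w j \<in> \<tau> (src g)"
  shows "hol_act g (\<lambda>c. \<Sum>j\<in>J. a j *\<^sub>R w j c) = (\<lambda>d. \<Sum>j\<in>J. a j *\<^sub>R hol_act g (w j) d)"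
proof -
  obtain \<gamma> where \<gamma>: "\<gamma> \<in> g" "leafwise_path \<gamma>" "\<forall>\<gamma>'\<in>g. holonomy_equiv \<gamma> \<gamma>'"
    "pathstart \<gamma> = src g" "pathfinish \<gamma> = rng g"
    using G_obtain_path[OF assms(1)] .
  have ends: "\<gamma> 0 = src g" "\<gamma> 1 = rng g"
    using \<gamma>(4,5) by (auto simp: pathstart_def pathfinish_def)
  obtain c d h where h: "has_holonomy \<gamma> c d h"
    by (rule has_holonomy_exists[OF \<gamma>(2)])
  define D where "D = frechet_derivative h (at (trc c (src g)))"
  have D: "linear D"
    using has_holonomy_flat(5)[OF h \<gamma>(2)] ends(1) has_derivative_linear by (auto simp: D_def)
  have act: "hol_act g w d = D (w c)" if w: "w \<in> \<tau> (src g)" for w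
  proof -
    obtain s where s: "flat \<gamma> s {0..1}" "s 0 = w"
      using flat_exists(1)[OF \<gamma>(2)] w ends by metis
    then show ?thesis
      using hol_act_flat[OF assms(1) \<gamma>(1) s(1)] has_holonomy_flat(6)[OF h \<gamma>(2) s(1)] ends by (simp add: D_def)
  qed
  note sum = \<tau>_sum[of w, OF assms(2), of a J]
  show ?thesis
  proof (rule \<tau>_eqI[of _ "rng g" _ d])
    show "hol_act g (\<lambda>c. \<Sum>j\<in>J. a j *\<^sub>R w j c) \<in> \<tau> (rng g)"
      using sum by (rule hol_act_in[OF assms(1)])
    show "(\<lambda>d. \<Sum>j\<in>J. a j *\<^sub>R hol_act g (w j) d) \<in> \<tau> (rng g)"
      using assms by (intro \<tau>_sum hol_act_in)
    show "d \<in> \<A>" "rng g \<in> fst d"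
      using has_holonomy_flat(3,4)[OF h \<gamma>(2)] ends by auto
    show "hol_act g (\<lambda>c. \<Sum>j\<in>J. a j *\<^sub>R w j c) d = (\<Sum>j\<in>J. a j *\<^sub>R hol_act g (w j) d)"
      using D by (simp add: act sum assms(2) linear_sum linear_scale)
  qed
qed

lemma hol_act_scale: "g \<in> G \<Longrightarrow> w \<in> \<tau> (src g) \<Longrightarrow> hol_act g (\<lambda>c. a *\<^sub>R w c) = (\<lambda>c. a *\<^sub>R hol_act g w c)"
  using hol_act_sum[of g "\<lambda>_. w" "\<lambda>_. a" "{()}"] by simp

lemma hol_act_add:
  "g \<in> G \<Longrightarrow> w \<in> \<tau> (src g) \<Longrightarrow> w' \<in> \<tau> (src g) \<Longrightarrow>
    hol_act g (\<lambda>c. w c + w' c) = (\<lambda>c. hol_act g w c + hol_act g w' c)"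
  using hol_act_sum[of g "\<lambda>i. if i then w else w'" "\<lambda>_. 1" UNIV] by (simp add: UNIV_bool add.commute)

lemma locally_const_joinpaths:
  assumes "locally_const \<gamma> s {0..1}" "locally_const \<gamma>' s' {0..1}" "pathfinish \<gamma> = pathstart \<gamma>'" "s 1 = s' 0"
  shows "locally_const (\<gamma> +++ \<gamma>') (\<lambda>t. if t \<le> 1/2 then s (2 * t) else s' (2 * t - 1)) {0..1}"
proof -
  let ?s = "\<lambda>t. if t \<le> 1/2 then s (2 * t) else s' (2 * t - 1)"
  have "isCont (\<lambda>t. 2 * t) t" "isCont (\<lambda>t. 2 * t - 1) t" for t :: real
    by (intro continuous_intros)+
  note cont = this
  have "locally_const (\<gamma> +++ \<gamma>') ?s {0..1/2}"
    by (rule locally_const_compose[OF assms(1) cont(1)]) (simp_all add: joinpaths_def)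
  moreover have "locally_const (\<gamma> +++ \<gamma>') ?s {1/2..1}"
  proof (rule locally_const_compose[OF assms(2) cont(2)])
    fix t :: real assume t: "t \<in> {1/2..1}"
    \<comment> \<open>At \<open>t = 1/2\<close> both \<open>+++\<close> and \<open>?s\<close> take
      their first branch; the matching end values make this agree with the second half.\<close>
    have "(\<gamma> +++ \<gamma>') t = \<gamma>' (2 * t - 1) \<and> ?s t = s' (2 * t - 1)"
    proof (cases "t = 1/2")
      case True
      then show ?thesis
        using assms(3,4) unfolding True by (simp add: joinpaths_def pathstart_def pathfinish_def)
    next
      case False
      then show ?thesis
        using t by (simp add: joinpaths_def)
    qed
    then show "(\<gamma> +++ \<gamma>') t = \<gamma>' (2 * t - 1)" "?s t = s' (2 * t - 1)"
      by blast+
  qed simp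
  ultimately show ?thesis
    by (rule locally_const_glue) simp_all
qed

lemma flat_joinpaths:
  assumes "flat \<gamma> s {0..1}" "flat \<gamma>' s' {0..1}" "pathfinish \<gamma> = pathstart \<gamma>'" "s 1 = s' 0"
  shows "flat (\<gamma> +++ \<gamma>') (\<lambda>t. if t \<le> 1/2 then s (2 * t) else s' (2 * t - 1)) {0..1}"
proof -
  have "s t \<in> \<tau> (\<gamma> t)" "s' t \<in> \<tau> (\<gamma>' t)" if "t \<in> {0..1}" for t
    using assms(1,2) that unfolding flat_def by blast+
  then have "\<forall>t\<in>{0..1}. (if t \<le> 1/2 then s (2 * t) else s' (2 * t - 1)) \<in> \<tau> ((\<gamma> +++ \<gamma>') t)"
    by (simp add: joinpaths_def)
  then show ?thesis
    using locally_const_joinpaths[of \<gamma> s \<gamma>' s'] assms unfolding flat_def by blast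
qed

text \<open>Being leafwise is local constancy of the transverse coordinates, so the lemma on
  concatenated sections applies to the path itself.\<close>

lemma leafwise_path_joinpaths:
  assumes "leafwise_path \<gamma>" "leafwise_path \<gamma>'" "pathfinish \<gamma> = pathstart \<gamma>'"
  shows "leafwise_path (\<gamma> +++ \<gamma>')"
proof -
  have "locally_const (\<gamma> +++ \<gamma>') (\<lambda>t. if t \<le> 1/2 then (\<lambda>c. trc c (\<gamma> (2 * t))) else (\<lambda>c. trc c (\<gamma>' (2 * t - 1)))) {0..1}"
    by (rule locally_const_joinpaths[OF leafwise_pathD(2)[OF assms(1)] leafwise_pathD(2)[OF assms(2)] assms(3)])
      (use assms(3) in \<open>simp add: pathstart_def pathfinish_def\<close>)
  then have "locally_const (\<gamma> +++ \<gamma>') (\<lambda>t c. trc c ((\<gamma> +++ \<gamma>') t)) {0..1}"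
    by (rule locally_const_cong) (simp add: joinpaths_def)
  moreover have "path (\<gamma> +++ \<gamma>')"
    by (rule path_join_imp[OF leafwise_pathD(1)[OF assms(1)] leafwise_pathD(1)[OF assms(2)] assms(3)])
  ultimately show ?thesis
    unfolding leafwise_path_iff by (rule conjI[rotated])
qed

text \<open>A flat section along the first path continues along the second from its end value; the
  concatenation shows that every member of \<open>comp g g'\<close> carries \<open>w\<close> to the
  iterated image.\<close>

lemma comp_facts:
  assumes "g \<in> G" "g' \<in> G" "src g = rng g'"
  shows src_comp: "src (comp g g') = src g'" and rng_comp: "rng (comp g g') = rng g"
    and hol_act_comp: "w \<in> \<tau> (src g') \<Longrightarrow> hol_act (comp g g') w = hol_act g (hol_act g' w)"
proof -
  obtain \<gamma>1 where \<gamma>1: "\<gamma>1 \<in> g" "leafwise_path \<gamma>1" "\<forall>\<gamma>'\<in>g. holonomy_equiv \<gamma>1 \<gamma>'"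
    "pathstart \<gamma>1 = src g" "pathfinish \<gamma>1 = rng g"
    using G_obtain_path[OF assms(1)] .
  obtain \<gamma>2 where \<gamma>2: "\<gamma>2 \<in> g'" "leafwise_path \<gamma>2" "\<forall>\<gamma>'\<in>g'. holonomy_equiv \<gamma>2 \<gamma>'"
    "pathstart \<gamma>2 = src g'" "pathfinish \<gamma>2 = rng g'"
    using G_obtain_path[OF assms(2)] .
  \<comment> \<open>A witness that the composite is nonempty, without which the \<open>SOME\<close>
    in \<open>src\<close> and \<open>rng\<close> says nothing.\<close>
  have "\<gamma>2 +++ \<gamma>1 \<in> comp g g'"
    unfolding comp_def using \<gamma>1(1,2,4) \<gamma>2(1,2,5) assms(3) holonomy_equiv_refl leafwise_path_joinpaths
    by (intro CollectI bexI[of _ \<gamma>1] bexI[of _ \<gamma>2]) simp_all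
  then have ne: "comp g g' \<noteq> {}" by blast
  have comp: "pathstart \<gamma> = src g' \<and> pathfinish \<gamma> = rng g \<and>
      (\<exists>\<gamma>\<^sub>1\<in>g. \<exists>\<gamma>\<^sub>2\<in>g'. holonomy_equiv (\<gamma>\<^sub>2 +++ \<gamma>\<^sub>1) \<gamma> \<and> leafwise_path \<gamma>\<^sub>2 \<and> pathstart \<gamma>\<^sub>2 = src g' \<and> pathfinish \<gamma>\<^sub>2 = pathstart \<gamma>\<^sub>1)"
    if \<gamma>: "\<gamma> \<in> comp g g'" for \<gamma>
  proof -
    obtain \<gamma>\<^sub>1 \<gamma>\<^sub>2 where *: "\<gamma>\<^sub>1 \<in> g" "\<gamma>\<^sub>2 \<in> g'" "holonomy_equiv \<gamma> (\<gamma>\<^sub>2 +++ \<gamma>\<^sub>1)"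
      using \<gamma> unfolding comp_def by blast
    then have "holonomy_equiv (\<gamma>\<^sub>2 +++ \<gamma>\<^sub>1) \<gamma>"
      unfolding holonomy_equiv_def by simp
    with * show ?thesis
      using holonomy_equivD[OF \<gamma>1(3)[rule_format, OF *(1)]] holonomy_equivD[OF \<gamma>2(3)[rule_format, OF *(2)]] holonomy_equivD[OF *(3)]
        \<gamma>1(4,5) \<gamma>2(4,5) assms(3) by (intro conjI bexI[of _ \<gamma>\<^sub>1] bexI[of _ \<gamma>\<^sub>2]) simp_all
  qed
  show "src (comp g g') = src g'" "rng (comp g g') = rng g"
    using comp by (auto intro!: src_eqI rng_eqI ne)
  assume w: "w \<in> \<tau> (src g')"
  show "hol_act (comp g g') w = hol_act g (hol_act g' w)"
  proof (rule hol_act_eqI[OF ne, where x = "src g'"])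
    fix \<gamma> assume "\<gamma> \<in> comp g g'"
    then obtain \<gamma>\<^sub>1 \<gamma>\<^sub>2 where *: "\<gamma>\<^sub>1 \<in> g" "\<gamma>\<^sub>2 \<in> g'" "holonomy_equiv (\<gamma>\<^sub>2 +++ \<gamma>\<^sub>1) \<gamma>"
        "leafwise_path \<gamma>\<^sub>2" "pathstart \<gamma>\<^sub>2 = src g'" "pathfinish \<gamma>\<^sub>2 = pathstart \<gamma>\<^sub>1"
      using comp by blast
    have lw: "leafwise_path \<gamma>\<^sub>1"
      using holonomy_equivD(2)[OF \<gamma>1(3)[rule_format, OF *(1)]] .
    obtain s where s: "flat \<gamma>\<^sub>2 s {0..1}" "s 0 = w"
      using flat_exists(1)[OF *(4)] w *(5) unfolding pathstart_def by metis
    have "s 1 \<in> \<tau> (\<gamma>\<^sub>1 0)"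
      using flat_ends(2)[OF s(1)] *(6) by (simp add: pathstart_def pathfinish_def)
    then obtain s' where s': "flat \<gamma>\<^sub>1 s' {0..1}" "s' 0 = s 1"
      using flat_exists(1)[OF lw] by blast
    have "s' 1 = hol_act g (hol_act g' w)"
      using hol_act_flat[OF assms(1) *(1) s'(1)] hol_act_flat[OF assms(2) *(2) s(1)] s(2) s'(2) by simp
    then show "carries \<gamma> w (hol_act g (hol_act g' w))"
      unfolding carries_def using flat_joinpaths[OF s(1) s'(1) *(6)] *(3) s(2) s'(2)
      by (intro exI[of _ "\<gamma>\<^sub>2 +++ \<gamma>\<^sub>1"] exI[of _ "\<lambda>t. if t \<le> 1/2 then s (2 * t) else s' (2 * t - 1)"] conjI) simp_all
  qed (use comp in blast)
qed

section \<open>Units of the holonomy groupoid\<close>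

lemma leafwise_path_const: "leafwise_path (\<lambda>_. x)"
  by (simp add: leafwise_path_def path_def)

lemma ident_in_G: "ident x \<in> G"
  using leafwise_path_const by (auto simp: ident_def G_def)

lemma ident_ends: "src (ident x) = x" "rng (ident x) = x"
proof -
  have "(\<lambda>_. x) \<in> ident x"
    by (simp add: ident_def hol_class_def holonomy_equiv_refl leafwise_path_const)
  then show "src (ident x) = x" "rng (ident x) = x"
    by (auto simp: ident_def hol_class_def pathstart_def pathfinish_def
        dest: holonomy_equivD(3,4) intro!: src_eqI rng_eqI)
qed

lemma hol_act_ident:
  assumes "w \<in> \<tau> x"
  shows "hol_act (ident x) w = w"
proof -
  have "flat (\<lambda>_. x) (\<lambda>_. w) {0..1}"
    using assms by (simp add: flat_def locally_const_def)
  then show ?thesis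
    using hol_act_flat[OF ident_in_G, of "\<lambda>_. x" x "\<lambda>_. w"]
    by (simp add: ident_def hol_class_def holonomy_equiv_refl leafwise_path_const)
qed

end

section \<open>The modular function\<close>

locale foliated_density_data = foliated_data \<A> b T \<omega> L
  for \<A> :: "('m::{t2_space,second_countable_topology}, real^'n::finite) chart set"
    and b :: "'q::finite \<Rightarrow> 'n"
    and T :: "'m set"
    and \<omega> :: "'m \<Rightarrow> ('q \<Rightarrow> ('m, real^'n) chart \<Rightarrow> real^'q) \<Rightarrow> real"
    and L :: "(real^'q) \<times> (real^'q^'q) \<Rightarrow> (real, 'k::{finite,linorder} option) vec" +
  assumes density: smooth_positive_density
begin

lemma hol_act_zero: "g \<in> G \<Longrightarrow> hol_act g (\<lambda>_. 0) = (\<lambda>_. 0)"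
  using hol_act_sum[of g "\<lambda>_ _. 0" "\<lambda>_. 0" "{}"] \<tau>_zero by simp

lemma positive_density_\<omega>: "x \<in> T \<Longrightarrow> positive_density (\<tau> x) (\<omega> x)"
  using density unfolding smooth_positive_density_def by blast

text \<open>A tuple is obtained from the coordinate frame by the matrix of its components in
  \<open>c\<close>, so the |det| rule reduces a density to its value on that frame.\<close>

lemma positive_density_frame:
  assumes \<rho>: "positive_density (\<tau> x) \<rho>" and c: "c \<in> \<A>" "x \<in> fst c"
  defines "e \<equiv> \<lambda>j. normal_vec_of x c (axis j 1)"
  shows "\<rho> e > 0" and "(\<And>i. w i \<in> \<tau> x) \<Longrightarrow> \<rho> w = \<bar>det (\<chi> i j. w i c $ j)\<bar> * \<rho> e"
proof -
  have e: "e j \<in> \<tau> x" "e j c = axis j 1" for j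
    using c by (auto simp: e_def normal_vec_of_in)
  have sum_axis: "(\<Sum>j\<in>UNIV. a j *\<^sub>R axis j 1) = (\<chi> j. a j)" for a :: "'q \<Rightarrow> real"
    using basis_expansion[of "\<chi> j. a j"] by (simp add: scalar_mult_eq_scaleR)
  have "a = (\<lambda>_. 0)" if "(\<lambda>c. \<Sum>j\<in>UNIV. a j *\<^sub>R e j c) = (\<lambda>_. 0)" for a
    using fun_cong[OF that, of c] by (auto simp: e sum_axis vec_eq_iff fun_eq_iff)
  then show "\<rho> e > 0"
    using \<rho> e(1) unfolding positive_density_def by blast
  assume w: "\<And>i. w i \<in> \<tau> x"
  define B :: "real^'q^'q" where "B = (\<chi> i j. w i c $ j)"
  have "w = (\<lambda>i d. \<Sum>j\<in>UNIV. (B $ i $ j) *\<^sub>R e j d)"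
  proof
    fix i show "w i = (\<lambda>d. \<Sum>j\<in>UNIV. (B $ i $ j) *\<^sub>R e j d)"
      by (rule \<tau>_eqI[OF w \<tau>_sum[OF e(1)] c]) (simp add: e sum_axis B_def)
  qed
  moreover have "\<rho> (\<lambda>i d. \<Sum>j\<in>UNIV. (B $ i $ j) *\<^sub>R e j d) = \<bar>det B\<bar> * \<rho> e"
    using \<rho> e(1) unfolding positive_density_def by blast
  ultimately show "\<rho> w = \<bar>det (\<chi> i j. w i c $ j)\<bar> * \<rho> e"
    by (simp add: B_def)
qed

lemma positive_density_nonzero:
  assumes "positive_density (\<tau> x) \<rho>"
  obtains w where "\<And>i. w i \<in> \<tau> x" "\<rho> w > 0"
  using charts_cover[of x] positive_density_frame(1)[OF assms] normal_vec_of_in by metis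

text \<open>Densities form a one-dimensional space; the constant is the ratio of the values on one
  coordinate frame.\<close>

lemma positive_densities_proportional:
  assumes "positive_density (\<tau> x) \<rho>" "positive_density (\<tau> x) \<rho>'"
  obtains a where "a > 0" "\<forall>w. (\<forall>i. w i \<in> \<tau> x) \<longrightarrow> \<rho> w = a * \<rho>' w"
proof -
  obtain c where c: "c \<in> \<A>" "x \<in> fst c"
    using charts_cover by blast
  let ?e = "\<lambda>j. normal_vec_of x c (axis j 1)"
  show ?thesis
  proof (rule that[of "\<rho> ?e / \<rho>' ?e"])
    show "\<rho> ?e / \<rho>' ?e > 0"
      using positive_density_frame(1) assms c by simp
    show "\<forall>w. (\<forall>i. w i \<in> \<tau> x) \<longrightarrow> \<rho> w = \<rho> ?e / \<rho>' ?e * \<rho>' w"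
    proof (intro allI impI)
      fix w :: "'q \<Rightarrow> ('m, 'n, 'q) normal_vec" assume "\<forall>i. w i \<in> \<tau> x"
      then have w: "w i \<in> \<tau> x" for i by blast
      show "\<rho> w = \<rho> ?e / \<rho>' ?e * \<rho>' w"
        using positive_density_frame(2)[OF assms(1) c w] positive_density_frame(2)[OF assms(2) c w]
          positive_density_frame(1)[OF assms(2) c] by simp
    qed
  qed
qed

text \<open>Linearity of the transport gives the determinant rule; injectivity keeps independent
  tuples independent, hence positivity.\<close>

lemma positive_density_pullback:
  assumes g: "g \<in> G" and \<rho>: "positive_density (\<tau> (rng g)) \<rho>"
  shows "positive_density (\<tau> (src g)) (\<lambda>w. \<rho> (\<lambda>i. hol_act g (w i)))"
  unfolding positive_density_def
proof (intro allI impI conjI)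
  fix w :: "'q \<Rightarrow> ('m, 'n, 'q) normal_vec" assume w: "\<forall>i. w i \<in> \<tau> (src g)"
  then have in_rng: "\<forall>i. hol_act g (w i) \<in> \<tau> (rng g)"
    using hol_act_in[OF g] by blast
  show "\<rho> (\<lambda>i. hol_act g (\<lambda>c. \<Sum>j\<in>UNIV. (B $ i $ j) *\<^sub>R w j c)) = \<bar>det B\<bar> * \<rho> (\<lambda>i. hol_act g (w i))"
    for B :: "real^'q^'q"
    using \<rho> in_rng w unfolding positive_density_def by (simp add: hol_act_sum[OF g])
  assume indep: "\<forall>a. (\<lambda>c. \<Sum>j\<in>UNIV. a j *\<^sub>R w j c) = (\<lambda>_. 0) \<longrightarrow> a = (\<lambda>_. 0)"
  have "a = (\<lambda>_. 0)" if "(\<lambda>c. \<Sum>j\<in>UNIV. a j *\<^sub>R hol_act g (w j) c) = (\<lambda>_. 0)" for a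
  proof -
    have "hol_act g (\<lambda>c. \<Sum>j\<in>UNIV. a j *\<^sub>R w j c) = hol_act g (\<lambda>_. 0)"
      by (rule trans[OF hol_act_sum[OF g] trans[OF that hol_act_zero[OF g, symmetric]]]) (use w in blast)
    then have "(\<lambda>c. \<Sum>j\<in>UNIV. a j *\<^sub>R w j c) = (\<lambda>_. 0)"
      by (rule inj_onD[OF bij_betw_imp_inj_on[OF hol_act_bij[OF g]]]) (use w in \<open>blast intro: \<tau>_sum \<tau>_zero\<close>)+
    then show ?thesis
      using indep by blast
  qed
  then show "\<rho> (\<lambda>i. hol_act g (w i)) > 0"
    using spec[OF \<rho>[unfolded positive_density_def], of "\<lambda>i. hol_act g (w i)"] in_rng by blast
qed

text \<open>A tuple on which the density at the source is positive forces the density of its image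
  to be nonzero, so the factor is determined. Only the source and the transport formula enter, so
  that \<open>comp g g'\<close> can be inserted as it stands.\<close>

lemma \<delta>_eqI:
  assumes "src g \<in> T"
    and a: "\<And>w. (\<And>i. w i \<in> \<tau> (src g)) \<Longrightarrow> \<omega> (src g) w = a * \<omega> (rng g) (\<lambda>i. hol_act g (w i))"
  shows "\<delta> g = a"
  unfolding \<delta>_def
proof (rule the_equality)
  show "\<forall>w. (\<forall>i. w i \<in> \<tau> (src g)) \<longrightarrow> \<omega> (src g) w = a * \<omega> (rng g) (\<lambda>i. hol_act g (w i))"
    using a by blast
next
  fix a' assume a': "\<forall>w. (\<forall>i. w i \<in> \<tau> (src g)) \<longrightarrow> \<omega> (src g) w = a' * \<omega> (rng g) (\<lambda>i. hol_act g (w i))"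
  obtain w where w: "\<And>i. w i \<in> \<tau> (src g)" "\<omega> (src g) w > 0"
    using positive_density_nonzero[OF positive_density_\<omega>[OF assms(1)]] by blast
  have "a * \<omega> (rng g) (\<lambda>i. hol_act g (w i)) = a' * \<omega> (rng g) (\<lambda>i. hol_act g (w i))"
    using a[of w] a' w(1) by metis
  moreover have "\<omega> (rng g) (\<lambda>i. hol_act g (w i)) \<noteq> 0"
    using a[of w] w by auto
  ultimately show "a' = a" by simp
qed

lemma \<delta>_properties:
  assumes "g \<in> G_T"
  shows \<delta>_pos: "\<delta> g > 0"
    and \<omega>_src: "(\<And>i. w i \<in> \<tau> (src g)) \<Longrightarrow> \<omega> (src g) w = \<delta> g * \<omega> (rng g) (\<lambda>i. hol_act g (w i))"
proof -
  have g: "g \<in> G" "src g \<in> T" "rng g \<in> T"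
    using assms by (auto simp: G_T_def)
  obtain a where a: "a > 0" "\<forall>w. (\<forall>i. w i \<in> \<tau> (src g)) \<longrightarrow> \<omega> (src g) w = a * \<omega> (rng g) (\<lambda>i. hol_act g (w i))"
    using positive_densities_proportional[OF positive_density_\<omega>[OF g(2)]
        positive_density_pullback[OF g(1) positive_density_\<omega>[OF g(3)]]] .
  have \<delta>: "\<delta> g = a"
    by (rule \<delta>_eqI[OF g(2)]) (use a(2) in blast)
  show "\<delta> g > 0"
    using a(1) \<delta> by simp
  show "\<omega> (src g) w = \<delta> g * \<omega> (rng g) (\<lambda>i. hol_act g (w i))" if "\<And>i. w i \<in> \<tau> (src g)"
    using a(2)[rule_format, OF that] \<delta> by simp
qed

lemma \<delta>_comp:
  assumes "g \<in> G_T" "g' \<in> G_T" "src g = rng g'"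
  shows "\<delta> (comp g g') = \<delta> g * \<delta> g'"
proof -
  have G: "g \<in> G" "g' \<in> G" "src g' \<in> T"
    using assms by (auto simp: G_T_def)
  note comp = comp_facts[OF G(1,2) assms(3)]
  show ?thesis
  proof (rule \<delta>_eqI)
    show "src (comp g g') \<in> T"
      using G comp(1) by simp
    fix w :: "'q \<Rightarrow> ('m, 'n, 'q) normal_vec" assume "\<And>i. w i \<in> \<tau> (src (comp g g'))"
    then have w: "\<And>i. w i \<in> \<tau> (src g')"
      by (simp add: comp)
    have "\<omega> (src g') w = \<delta> g' * \<omega> (rng g') (\<lambda>i. hol_act g' (w i))"
      by (rule \<omega>_src[OF assms(2) w])
    also have "\<omega> (rng g') (\<lambda>i. hol_act g' (w i)) = \<delta> g * \<omega> (rng g) (\<lambda>i. hol_act g (hol_act g' (w i)))"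
      using \<omega>_src[OF assms(1), of "\<lambda>i. hol_act g' (w i)"] hol_act_in[OF G(2) w] assms(3) by simp
    finally show "\<omega> (src (comp g g')) w = \<delta> g * \<delta> g' * \<omega> (rng (comp g g')) (\<lambda>i. hol_act (comp g g') (w i))"
      by (simp add: comp w)
  qed
qed

lemma \<delta>_ident: "x \<in> T \<Longrightarrow> \<delta> (ident x) = 1"
  by (rule \<delta>_eqI) (simp_all add: ident_ends hol_act_ident)

text \<open>The first component can be read off once the \<open>THE\<close> in
  \<open>SMet_act\<close> has a unique solution, so the push-forward of the form is normalised
  explicitly. The base point obtained here decides which arrows compose.\<close>

lemma fst_SMet_act:
  assumes g: "g \<in> G_T" and u: "u \<in> SMet" and src: "src g = fst u"
  shows "fst (SMet_act g u) = rng g"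
proof -
  have G: "g \<in> G" "rng g \<in> T"
    using g by (auto simp: G_T_def)
  define E where "E = \<tau> (rng g)"
  define \<iota> where "\<iota> = inv_into (\<tau> (src g)) (hol_act g)"
  define Q where "Q = snd u"
  define F where "F a w = (if w \<in> E then a * Q (\<iota> w) else 0)" for a w
  have Q: "pos_def_quadratic_form (\<tau> (src g)) Q"
    and dens: "\<And>w. (\<And>i. w i \<in> \<tau> (src g)) \<Longrightarrow> form_density Q w = \<omega> (src g) w"
    using u src by (auto simp: SMet_def Q_def)
  have bij: "bij_betw (hol_act g) (\<tau> (src g)) E"
    using hol_act_bij[OF G(1)] by (simp add: E_def)
  have \<iota>: "\<iota> w \<in> \<tau> (src g)" "hol_act g (\<iota> w) = w" if "w \<in> E" for w
    using that bij unfolding \<iota>_def by (auto simp: bij_betw_def inv_into_into f_inv_into_f)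
  have \<iota>_eq: "\<iota> w = v" if "v \<in> \<tau> (src g)" "hol_act g v = w" for v w
    using that bij by (auto simp: \<iota>_def bij_betw_def)
  have E_add: "(\<lambda>c. v c + w c) \<in> E" "\<iota> (\<lambda>c. v c + w c) = (\<lambda>c. \<iota> v c + \<iota> w c)" if "v \<in> E" "w \<in> E" for v w
    using that \<iota> by (auto simp: E_def \<tau>_add hol_act_add[OF G(1)] intro!: \<iota>_eq)
  have E_scale: "(\<lambda>c. a *\<^sub>R w c) \<in> E" "\<iota> (\<lambda>c. a *\<^sub>R w c) = (\<lambda>c. a *\<^sub>R \<iota> w c)" if "w \<in> E" for a w
    using that \<iota> by (auto simp: E_def \<tau>_scale hol_act_scale[OF G(1)] intro!: \<iota>_eq)
  have polar_F: "polar (F a) v w = a * polar Q (\<iota> v) (\<iota> w)" if "v \<in> E" "w \<in> E" for a v w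
    using that by (simp add: polar_def F_def E_add algebra_simps diff_divide_distrib)
  have F_pos_def: "pos_def_quadratic_form E (F a)" if "a > 0" for a
    unfolding pos_def_quadratic_form_def
  proof (intro conjI allI ballI impI)
    show "F a v = 0" if "v \<notin> E" for v
      using that by (simp add: F_def)
    show "F a (\<lambda>c. r *\<^sub>R v c) = r\<^sup>2 * F a v" if "v \<in> E" for v r
      using Q \<iota>(1)[OF that] that by (simp add: F_def E_scale pos_def_quadratic_form_def)
    show "polar (F a) (\<lambda>c. r *\<^sub>R u c + v c) w = r * polar (F a) u w + polar (F a) v w"
      if "u \<in> E" "v \<in> E" "w \<in> E" for u v w r
      using Q \<iota>(1)[OF that(1)] \<iota>(1)[OF that(2)] \<iota>(1)[OF that(3)] that
      by (simp add: polar_F E_scale E_add pos_def_quadratic_form_def distrib_left)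
    show "F a v > 0" if "v \<in> E" "v \<noteq> (\<lambda>_. 0)" for v
    proof -
      have "\<iota> v \<noteq> (\<lambda>_. 0)"
      proof
        assume "\<iota> v = (\<lambda>_. 0)"
        then have "v = hol_act g (\<lambda>_. 0)"
          using \<iota>(2)[OF that(1)] by simp
        then show False
          using hol_act_scale[OF G(1) \<tau>_zero, of 0] that(2) by simp
      qed
      then have "Q (\<iota> v) > 0"
        using Q \<iota>(1)[OF that(1)] unfolding pos_def_quadratic_form_def by blast
      then show ?thesis
        using that \<open>a > 0\<close> by (simp add: F_def)
    qed
  qed
  \<comment> \<open>Each of the q rows of the Gram matrix contributes a factor \<open>a\<close>, and
    \<open>\<omega>_src\<close> trades the density at the source for \<open>\<delta> g\<close> times
    the density at the range.\<close>
  have F_density: "form_density (F a) w = sqrt (a ^ CARD('q)) * \<delta> g * \<omega> (rng g) w" if "\<And>i. w i \<in> E" for a w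
  proof -
    have "(\<chi> i j. polar (F a) (w i) (w j)) = (\<chi> i. a *s (\<chi> j. polar Q (\<iota> (w i)) (\<iota> (w j))))"
      by (simp add: vec_eq_iff polar_F that)
    then have "form_density (F a) w = sqrt (a ^ CARD('q)) * form_density Q (\<lambda>i. \<iota> (w i))"
      unfolding form_density_def by (simp add: det_rows_mul real_sqrt_mult)
    also have "form_density Q (\<lambda>i. \<iota> (w i)) = \<delta> g * \<omega> (rng g) w"
      using dens[of "\<lambda>i. \<iota> (w i)"] \<omega>_src[OF g, of "\<lambda>i. \<iota> (w i)"] \<iota> that by simp
    finally show ?thesis by simp
  qed
  have in_SMet: "(rng g, F a) \<in> SMet \<longleftrightarrow> sqrt (a ^ CARD('q)) * \<delta> g = 1" if "a > 0" for a
  proof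
    assume "(rng g, F a) \<in> SMet"
    then have eq: "form_density (F a) w = \<omega> (rng g) w" if "\<And>i. w i \<in> E" for w
      using that by (auto simp: SMet_def E_def)
    obtain w where w: "\<And>i. w i \<in> E" "\<omega> (rng g) w > 0"
      unfolding E_def using positive_density_nonzero[OF positive_density_\<omega>[OF G(2)]] by blast
    show "sqrt (a ^ CARD('q)) * \<delta> g = 1"
      using eq[of w, OF w(1)] F_density[of w a, OF w(1)] w(2) by simp
  next
    assume "sqrt (a ^ CARD('q)) * \<delta> g = 1"
    then show "(rng g, F a) \<in> SMet"
      using F_pos_def[OF that] F_density G by (auto simp: SMet_def E_def)
  qed
  \<comment> \<open>The equation a^(q/2) * \<delta>(g) = 1 has exactly one positive root, which
    gives both existence and uniqueness for the description of \<open>SMet_act\<close>.\<close>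
  have scale_iff: "sqrt (a ^ CARD('q)) * \<delta> g = 1 \<longleftrightarrow> a = root CARD('q) (1 / (\<delta> g)\<^sup>2)" if "a > 0" for a
  proof -
    have "sqrt (a ^ CARD('q)) * \<delta> g = 1 \<longleftrightarrow> a ^ CARD('q) = (1 / \<delta> g)\<^sup>2"
      using \<delta>_pos[OF g] that by (smt (verit) divide_pos_pos nonzero_eq_divide_eq real_sqrt_abs
          real_sqrt_eq_iff abs_of_pos)
    also have "\<dots> \<longleftrightarrow> a = root CARD('q) (1 / (\<delta> g)\<^sup>2)"
      using that \<delta>_pos[OF g] by (metis real_root_power_cancel real_root_pow_pos2 zero_less_card_finite
          less_imp_le power_one_over zero_le_power2 zero_less_divide_1_iff)
    finally show ?thesis .
  qed
  have F_eq: "(\<lambda>w. if w \<in> \<tau> (rng g) then a * snd u (inv_into (\<tau> (src g)) (hol_act g) w) else 0) = F a" for a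
    by (simp add: fun_eq_iff F_def E_def Q_def \<iota>_def)
  define r where "r = root CARD('q) (1 / (\<delta> g)\<^sup>2)"
  have r: "r > 0"
    using \<delta>_pos[OF g] by (simp add: r_def)
  have "SMet_act g u = (rng g, F r)"
    unfolding SMet_act_def F_eq
  proof (rule the_equality)
    show "(rng g, F r) \<in> SMet \<and> (\<exists>a>0. (rng g, F r) = (rng g, F a))"
      using in_SMet[OF r] scale_iff[OF r] r_def r by blast
  next
    fix u' assume "u' \<in> SMet \<and> (\<exists>a>0. u' = (rng g, F a))"
    then obtain a where "a > 0" "u' \<in> SMet" "u' = (rng g, F a)"
      by blast
    then show "u' = (rng g, F r)"
      using in_SMet[of a] scale_iff[of a] by (simp add: r_def)
  qed
  then show ?thesis by simp
qed

end

section \<open>Invariance of the cocycle\<close>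

text \<open>The factor \<open>g x\<close> is fixed on a neighbourhood of \<open>x\<close>, so
  differentiating there gives the same relation between the derivatives of \<open>h\<close> and
  \<open>f\<close>, with the same \<open>g\<close>; this makes the induction on \<open>k\<close>
  close.\<close>

lemma Ck_on_locally_const_mult:
  fixes f h :: "'a::real_normed_vector \<Rightarrow> complex"
  assumes "open S" "\<And>x. x \<in> S \<Longrightarrow> \<forall>\<^sub>F y in nhds x. h y = g x * f y" "Ck_on k S f"
  shows "Ck_on k S h"
  using assms(2,3)
proof (induction k arbitrary: f h)
  case 0
  have "isCont h x" if "x \<in> S" for x
  proof -
    have "isCont (\<lambda>y. g x * f y) x"
      using 0(2) that \<open>open S\<close> by (auto intro!: continuous_intros simp: continuous_on_eq_continuous_at)
    then show ?thesis
      using isCont_cong[OF 0(1)[OF that]] by simp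
  qed
  then show ?case
    by (simp add: continuous_at_imp_continuous_on)
next
  case (Suc k)
  have deriv: "(h has_derivative (\<lambda>v. g x * frechet_derivative f (at x) v)) (at x)" if "x \<in> S" for x
  proof -
    have "f differentiable (at x)"
      using Suc.prems(2) that by simp
    then have "(f has_derivative frechet_derivative f (at x)) (at x)"
      by (simp add: frechet_derivative_works)
    then show ?thesis
      by (intro has_derivative_cong_nhds[OF Suc.prems(1)[OF that]] has_derivative_mult_right)
  qed
  have "Ck_on k S (\<lambda>x. frechet_derivative h (at x) v)" for v
  proof (rule Suc.IH)
    show "Ck_on k S (\<lambda>x. frechet_derivative f (at x) v)"
      using Suc.prems(2) by simp
    show "\<forall>\<^sub>F y in nhds x. frechet_derivative h (at y) v = g x * frechet_derivative f (at y) v" if "x \<in> S" for x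
    proof -
      \<comment> \<open>To be differentiated at a nearby \<open>y\<close>, the relation must hold
        around \<open>y\<close>, still with the factor belonging to \<open>x\<close>.\<close>
      have "\<forall>\<^sub>F y in nhds x. \<forall>\<^sub>F z in nhds y. h z = g x * f z"
        using Suc.prems(1)[OF that] by (simp add: eventually_eventually)
      moreover have "\<forall>\<^sub>F y in nhds x. y \<in> S"
        using eventually_nhds_in_open[OF \<open>open S\<close> that] .
      ultimately show ?thesis
      proof eventually_elim
        case (elim y)
        then have "f differentiable (at y)"
          using Suc.prems(2) by simp
        then have "(f has_derivative frechet_derivative f (at y)) (at y)"
          by (simp add: frechet_derivative_works)
        then have "(h has_derivative (\<lambda>v. g x * frechet_derivative f (at y) v)) (at y)"
          by (intro has_derivative_cong_nhds[OF elim(1)] has_derivative_mult_right)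
        then show ?case
          using frechet_derivative_at by metis
      qed
    qed
  qed
  then show ?case
    using deriv by (auto simp: differentiable_def)
qed

lemma smooth_on_locally_const_mult:
  fixes f h :: "'a::real_normed_vector \<Rightarrow> complex"
  assumes "open S" "\<And>x. x \<in> S \<Longrightarrow> \<forall>\<^sub>F y in nhds x. h y = g x * f y" "smooth_on S f"
  shows "smooth_on S h"
  using Ck_on_locally_const_mult[OF assms(1,2)] assms(3) unfolding smooth_on_def by blast

lemma wedge_scale:
  "wedge (\<lambda>vs. x * \<alpha> vs) (\<lambda>vs. y * \<beta> vs) vs = x * y * wedge \<alpha> \<beta> vs"
  unfolding wedge_def sum_distrib_left by (rule sum.cong) (simp_all add: mult_ac)

locale foliated_invariant_density_data = foliated_density_data \<A> b T \<omega> L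
  for \<A> :: "('m::{t2_space,second_countable_topology}, real^'n::finite) chart set"
    and b :: "'q::finite \<Rightarrow> 'n"
    and T :: "'m set"
    and \<omega> :: "'m \<Rightarrow> ('q \<Rightarrow> ('m, real^'n) chart \<Rightarrow> real^'q) \<Rightarrow> real"
    and L :: "(real^'q) \<times> (real^'q^'q) \<Rightarrow> (real, 'k::{finite,linorder} option) vec" +
  assumes invariant: projectively_invariant
begin

section \<open>The phase \<delta>^(it) on arrows and on forms\<close>

definition modular_phase :: "real \<Rightarrow> ('m, 'n, 'q) arrow \<Rightarrow> complex" where
  "modular_phase t a = complex_of_real (\<delta> (fst a)) powr (\<i> * complex_of_real t)"

lemma \<sigma>_eq: "\<sigma> t f a = modular_phase t a * f a"
  by (simp add: \<sigma>_def modular_phase_def)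

lemma arrow_chart_arrows:
  assumes "(N, c) \<in> arrow_charts"
  shows "N \<subseteq> arrows"
proof -
  have "openin arrow_topology N"
    using assms by (cases c) (auto simp: arrow_charts_def)
  then show ?thesis
    unfolding arrow_topology_def by (auto simp: openin_subtopology)
qed

text \<open>The middle unit is a metric, whereas \<open>\<delta>_comp\<close> asks for equal base
  points in \<open>T\<close>; \<open>fst_SMet_act\<close> supplies the base point of the
  range.\<close>

lemma arrow_composable:
  assumes "a' \<in> arrows" "a'' \<in> arrows" "asrc a' = arng a''"
  shows "src (fst a') = rng (fst a'')"
proof -
  have "fst (arng a'') = rng (fst a'')"
    using assms(2) fst_SMet_act by (auto simp: arrows_def arng_def)
  then show ?thesis
    using assms by (auto simp: arrows_def asrc_def)
qed

text \<open>Complex \<open>powr\<close> is multiplicative in the base for nonnegative reals, which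
  is where positivity of \<open>\<delta>\<close> enters.\<close>

lemma modular_phase_mult:
  assumes "a' \<in> arrows" "a'' \<in> arrows" "asrc a' = arng a''"
  shows "modular_phase t (amult a' a'') = modular_phase t a' * modular_phase t a''"
proof -
  have "fst a' \<in> G_T" "fst a'' \<in> G_T"
    using assms by (auto simp: arrows_def)
  then show ?thesis
    using \<delta>_comp[OF _ _ arrow_composable[OF assms]] \<delta>_pos
    by (simp add: modular_phase_def amult_def powr_times_real less_imp_le)
qed

lemma modular_phase_unit: "u \<in> SMet \<Longrightarrow> modular_phase t (unit_arrow u) = 1"
  by (auto simp: modular_phase_def unit_arrow_def SMet_def \<delta>_ident)

lemma modular_phase_inverse:
  assumes "a \<in> arrows"
  shows "modular_phase (- t) a * modular_phase t a = 1"
proof -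
  have "\<delta> (fst a) > 0"
    using assms by (auto simp: arrows_def intro: \<delta>_pos)
  then show ?thesis
    by (simp add: modular_phase_def powr_minus)
qed

text \<open>Pull a neighbourhood of constancy of \<open>\<delta>\<close> back along the continuous
  projection of arrows to \<open>G_T\<close>; the chart is a homeomorphism onto an open set, so the
  trace on \<open>N\<close> becomes an open set of coordinates.\<close>

lemma modular_phase_locally_const:
  assumes "(N, (V, \<kappa>)) \<in> arrow_charts" "a \<in> N"
  shows "\<forall>\<^sub>F y in nhds (\<kappa> (arng a)).
    modular_phase t (inv_into N (\<kappa> \<circ> arng) y) = modular_phase t a"
proof -
  let ?X = "subtopology arrow_topology N" and ?S = "\<kappa> ` arng ` N"
  have N: "openin arrow_topology N" "open ?S"
    and hom: "homeomorphic_map ?X (top_of_set ?S) (\<kappa> \<circ> arng)"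
    using assms(1) by (auto simp: arrow_charts_def)
  have topX: "topspace ?X = N"
    using openin_subset[OF N(1)] by auto
  have "fst a \<in> G_T"
    using arrow_chart_arrows[OF assms(1)] assms(2) by (auto simp: arrows_def)
  then obtain N' where N': "openin G_T_topology N'" "fst a \<in> N'" "\<forall>g\<in>N'. \<delta> g = \<delta> (fst a)"
    using invariant unfolding projectively_invariant_def by blast
  have "continuous_map arrow_topology G_T_topology fst"
    unfolding arrow_topology_def by (intro continuous_map_from_subtopology continuous_map_fst)
  then have "openin arrow_topology {a' \<in> topspace arrow_topology. fst a' \<in> N'}"
    using N'(1) by (rule openin_continuous_map_preimage)
  then have "openin ?X (N \<inter> {a' \<in> topspace arrow_topology. fst a' \<in> N'})"
    by (rule openin_subtopology_Int2)
  moreover define U where "U = {a' \<in> N. fst a' \<in> N'}"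
  moreover have "N \<inter> {a' \<in> topspace arrow_topology. fst a' \<in> N'} = U"
    using openin_subset[OF N(1)] unfolding U_def by blast
  ultimately have "openin ?X U"
    by (simp only:)
  then have "openin (top_of_set ?S) ((\<kappa> \<circ> arng) ` U)"
    using homeomorphic_imp_open_map[OF hom] unfolding open_map_def by blast
  then have "open ((\<kappa> \<circ> arng) ` U)"
    using N(2) openin_open_trans by blast
  moreover have "\<kappa> (arng a) \<in> (\<kappa> \<circ> arng) ` U"
    using assms(2) N'(2) by (auto simp: U_def)
  moreover have "modular_phase t (inv_into N (\<kappa> \<circ> arng) y) = modular_phase t a" if y: "y \<in> (\<kappa> \<circ> arng) ` U" for y
  proof -
    obtain a' where a': "a' \<in> N" "fst a' \<in> N'" "y = (\<kappa> \<circ> arng) a'"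
      using y unfolding U_def by blast
    have "inj_on (\<kappa> \<circ> arng) N"
      using homeomorphic_imp_injective_map[OF hom] topX by simp
    then have "inv_into N (\<kappa> \<circ> arng) y = a'"
      using a' by (simp only: inv_into_f_f)
    then show ?thesis
      using bspec[OF N'(3) a'(2)] by (simp add: modular_phase_def)
  qed
  ultimately show ?thesis
    unfolding eventually_nhds by blast
qed

lemma \<sigma>_in_chart:
  assumes "(N, (V, \<kappa>)) \<in> arrow_charts" "a \<in> N"
  shows "\<forall>\<^sub>F y in nhds (\<kappa> (arng a)).
    (\<sigma> t f \<circ> inv_into N (\<kappa> \<circ> arng)) y = modular_phase t a * (f \<circ> inv_into N (\<kappa> \<circ> arng)) y"
  using modular_phase_locally_const[OF assms, of t]
  by eventually_elim (simp add: \<sigma>_eq)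

text \<open>In coordinates the phase is locally a constant factor: smoothness and support survive,
  and the differential picks up the phase without a term containing its derivative. Off
  \<open>N\<close> both differentials are zero.\<close>

lemma elementary_\<sigma>:
  assumes "elementary C f"
  shows "elementary C (\<sigma> t f)"
    and "elementary_diff C (\<sigma> t f) a vs = modular_phase t a * elementary_diff C f a vs"
proof -
  obtain N V \<kappa> where C: "C = (N, (V, \<kappa>))"
    by (cases C; cases "snd C") auto
  have N: "(N, (V, \<kappa>)) \<in> arrow_charts" and f0: "\<And>a. a \<notin> N \<Longrightarrow> f a = 0"
    and sm: "smooth_on (\<kappa> ` arng ` N) (f \<circ> inv_into N (\<kappa> \<circ> arng))"
    and cpt: "\<exists>K. compact K \<and> K \<subseteq> \<kappa> ` arng ` N \<and> (\<forall>a\<in>N. \<kappa> (arng a) \<notin> K \<longrightarrow> f a = 0)"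
    using assms by (auto simp: C elementary_def)
  have op: "open (\<kappa> ` arng ` N)"
    using N by (auto simp: arrow_charts_def)
  have "smooth_on (\<kappa> ` arng ` N) (\<sigma> t f \<circ> inv_into N (\<kappa> \<circ> arng))"
  proof (rule smooth_on_locally_const_mult[OF op _ sm])
    fix y assume y: "y \<in> \<kappa> ` arng ` N"
    define a where "a = inv_into N (\<kappa> \<circ> arng) y"
    have "y \<in> (\<kappa> \<circ> arng) ` N"
      using y by (simp add: image_comp)
    then have "a \<in> N" "\<kappa> (arng a) = y"
      using inv_into_into[of y "\<kappa> \<circ> arng" N] f_inv_into_f[of y "\<kappa> \<circ> arng" N] by (simp_all add: a_def)
    then show "\<forall>\<^sub>F z in nhds y. (\<sigma> t f \<circ> inv_into N (\<kappa> \<circ> arng)) z =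
        modular_phase t (inv_into N (\<kappa> \<circ> arng) y) * (f \<circ> inv_into N (\<kappa> \<circ> arng)) z"
      using \<sigma>_in_chart[OF N, of a t f] by (simp add: a_def)
  qed
  moreover have "\<exists>K. compact K \<and> K \<subseteq> \<kappa> ` arng ` N \<and> (\<forall>a\<in>N. \<kappa> (arng a) \<notin> K \<longrightarrow> \<sigma> t f a = 0)"
    using cpt by (auto simp: \<sigma>_eq)
  ultimately show "elementary C (\<sigma> t f)"
    using N f0 by (simp add: C elementary_def \<sigma>_eq)
  have "frechet_derivative (\<sigma> t f \<circ> inv_into N (\<kappa> \<circ> arng)) (at (\<kappa> (arng a))) v =
      modular_phase t a * frechet_derivative (f \<circ> inv_into N (\<kappa> \<circ> arng)) (at (\<kappa> (arng a))) v"
    if a: "a \<in> N" for v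
  proof -
    have "Ck_on (Suc 0) (\<kappa> ` arng ` N) (f \<circ> inv_into N (\<kappa> \<circ> arng))"
      using sm unfolding smooth_on_def by blast
    then have "(f \<circ> inv_into N (\<kappa> \<circ> arng)) differentiable (at (\<kappa> (arng a)))"
      using a by simp
    then have "((f \<circ> inv_into N (\<kappa> \<circ> arng)) has_derivative
        frechet_derivative (f \<circ> inv_into N (\<kappa> \<circ> arng)) (at (\<kappa> (arng a)))) (at (\<kappa> (arng a)))"
      by (simp only: frechet_derivative_works)
    then have "((\<sigma> t f \<circ> inv_into N (\<kappa> \<circ> arng)) has_derivative
        (\<lambda>v. modular_phase t a * frechet_derivative (f \<circ> inv_into N (\<kappa> \<circ> arng)) (at (\<kappa> (arng a))) v)) (at (\<kappa> (arng a)))"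
      by (intro has_derivative_cong_nhds[OF \<sigma>_in_chart[OF N a]] has_derivative_mult_right)
    from frechet_derivative_at[OF this] show ?thesis
      by metis
  qed
  then show "elementary_diff C (\<sigma> t f) a vs = modular_phase t a * elementary_diff C f a vs"
    unfolding C elementary_diff_def by (cases "a \<in> N") (simp_all split: list.split)
qed

text \<open>Multiplying each summand by the phase turns a decomposition of \<open>f\<close> into one
  of \<open>\<sigma> t f\<close>, so every differential is carried along, whichever decomposition it
  came from.\<close>

lemma is_differential_\<sigma>:
  assumes "is_differential f \<theta>"
  shows "is_differential (\<sigma> t f) (\<lambda>a vs. modular_phase t a * \<theta> a vs)"
proof -
  obtain n C F where F: "\<forall>i<n::nat. elementary (C i) (F i)" "f = (\<lambda>a. \<Sum>i<n. F i a)"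
      "\<theta> = (\<lambda>a vs. \<Sum>i<n. elementary_diff (C i) (F i) a vs)"
    using assms unfolding is_differential_def by blast
  have "\<forall>i<n. elementary (C i) (\<sigma> t (F i))"
    using F(1) elementary_\<sigma>(1) by blast
  moreover have "\<sigma> t f = (\<lambda>a. \<Sum>i<n. \<sigma> t (F i) a)"
    by (simp add: fun_eq_iff \<sigma>_eq F(2) sum_distrib_left)
  moreover have "(\<lambda>a vs. modular_phase t a * \<theta> a vs) = (\<lambda>a vs. \<Sum>i<n. elementary_diff (C i) (\<sigma> t (F i)) a vs)"
    unfolding F(3) sum_distrib_left using F(1) by (intro ext sum.cong refl elementary_\<sigma>(2)[symmetric]) simp
  ultimately show ?thesis
    unfolding is_differential_def by (intro exI[of _ n] exI[of _ C] exI[of _ "\<lambda>i. \<sigma> t (F i)"] conjI)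
qed

text \<open>All factorisations of \<open>a\<close> contribute the same factor, the phase of
  \<open>a\<close>, because the phase is multiplicative on composable pairs; it then leaves the
  infinite sum as a scalar.\<close>

lemma convolve_modular_phase:
  "convolve (\<lambda>a vs. modular_phase t a * \<alpha> a vs) (\<lambda>a vs. modular_phase t a * \<beta> a vs) =
    (\<lambda>a vs. modular_phase t a * convolve \<alpha> \<beta> a vs)"
proof (intro ext)
  fix a vs
  let ?P = "{(a', a''). a' \<in> arrows \<and> a'' \<in> arrows \<and> asrc a' = arng a'' \<and> a = amult a' a''}"
  have "convolve (\<lambda>a vs. modular_phase t a * \<alpha> a vs) (\<lambda>a vs. modular_phase t a * \<beta> a vs) a vs =
      (\<Sum>\<^sub>\<infinity>p\<in>?P. modular_phase t a *
        (case p of (a', a'') \<Rightarrow> wedge (\<alpha> a') (\<lambda>ws. \<beta> a'' (map (pull_tangent a') ws)) vs))"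
    unfolding convolve_def
    by (rule infsum_cong) (auto simp: wedge_scale modular_phase_mult)
  also have "\<dots> = modular_phase t a * convolve \<alpha> \<beta> a vs"
    unfolding convolve_def by (rule infsum_cmult_right')
  finally show "convolve (\<lambda>a vs. modular_phase t a * \<alpha> a vs) (\<lambda>a vs. modular_phase t a * \<beta> a vs) a vs =
    modular_phase t a * convolve \<alpha> \<beta> a vs" .
qed

lemma cocycle_product_\<sigma>:
  "cocycle_product (\<sigma> t f) (\<lambda>j a vs. modular_phase t a * \<theta> j a vs) n =
    (\<lambda>a vs. modular_phase t a * cocycle_product f \<theta> n a vs)"
proof (induction n)
  case 0
  show ?case
    by (intro ext) (simp add: \<sigma>_eq)
next
  case (Suc n)
  show ?case
    by (simp only: cocycle_product.simps Suc.IH convolve_modular_phase)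
qed

text \<open>A factorisation of \<open>unit_arrow u\<close> has \<open>u\<close> as the source of its
  second arrow, so none exists off \<open>SMet\<close>. This lets integrands be compared as
  functions on the whole type.\<close>

lemma convolve_off_units:
  assumes "u \<notin> SMet"
  shows "convolve \<alpha> \<beta> (unit_arrow u) vs = 0"
proof -
  have "{(a', a''). a' \<in> arrows \<and> a'' \<in> arrows \<and> asrc a' = arng a'' \<and> unit_arrow u = amult a' a''} = {}"
    using assms by (auto simp: unit_arrow_def amult_def arrows_def)
  then show ?thesis
    unfolding convolve_def by (simp only: infsum_empty)
qed

text \<open>On \<open>SMet\<close> the phase of a unit is 1; elsewhere both products vanish, which
  takes at least one convolution, hence \<open>n > 0\<close>.\<close>

lemma cocycle_product_\<sigma>_unit:
  assumes "n > 0"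
  shows "cocycle_product (\<sigma> t f) (\<lambda>j a vs. modular_phase t a * \<theta> j a vs) n (unit_arrow u) =
    cocycle_product f \<theta> n (unit_arrow u)"
proof (cases "u \<in> SMet")
  case True
  then show ?thesis
    by (simp add: cocycle_product_\<sigma> modular_phase_unit)
next
  case False
  then show ?thesis
    using assms by (cases n) (auto simp: convolve_off_units)
qed

text \<open>The predicate under the \<open>THE\<close> of \<open>\<phi>\<close>, named so that the
  admissible values for two families of functions can be compared.\<close>

definition cocycle_value :: "(nat \<Rightarrow> ('m, 'n, 'q) arrow \<Rightarrow> complex) \<Rightarrow> complex \<Rightarrow> bool" where
  "cocycle_value f I \<longleftrightarrow> (\<exists>\<theta>. (\<forall>j\<in>{1..CARD('k)}. is_differential (f j) (\<theta> j)) \<and>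
     has_form_integral SMet_charts SMet (\<lambda>u. cocycle_product (f 0) \<theta> CARD('k) (unit_arrow u)) I)"

lemma cocycle_value_\<sigma>:
  assumes "cocycle_value f I"
  shows "cocycle_value (\<lambda>j. \<sigma> t (f j)) I"
proof -
  obtain \<theta> where \<theta>: "\<forall>j\<in>{1..CARD('k)}. is_differential (f j) (\<theta> j)"
    "has_form_integral SMet_charts SMet (\<lambda>u. cocycle_product (f 0) \<theta> CARD('k) (unit_arrow u)) I"
    using assms unfolding cocycle_value_def by blast
  have "(\<lambda>u. cocycle_product (\<sigma> t (f 0)) (\<lambda>j a vs. modular_phase t a * \<theta> j a vs) CARD('k) (unit_arrow u)) =
      (\<lambda>u. cocycle_product (f 0) \<theta> CARD('k) (unit_arrow u))"
    by (intro ext cocycle_product_\<sigma>_unit[THEN fun_cong]) simp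
  then show ?thesis
    unfolding cocycle_value_def using \<theta> is_differential_\<sigma>
    by (intro exI[of _ "\<lambda>j a vs. modular_phase t a * \<theta> j a vs"]) simp
qed

text \<open>Chart domains consist of arrows. Positivity of \<open>\<delta>\<close>, and with it the
  inverse phase, is only available on arrows, so \<open>\<sigma>_inverse\<close> relies on vanishing
  elsewhere.\<close>

lemma Cc_smooth_off_arrows:
  assumes "f \<in> Cc_smooth" "a \<notin> arrows"
  shows "f a = 0"
proof -
  obtain n C F where F: "\<forall>i<n::nat. elementary (C i) (F i)" "f = (\<lambda>a. \<Sum>i<n. F i a)"
    using assms unfolding Cc_smooth_def by blast
  have "F i a = 0" if i: "i < n" for i
  proof -
    obtain N c where "C i = (N, c)" "(N, c) \<in> arrow_charts" "\<forall>a. a \<notin> N \<longrightarrow> F i a = 0"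
      using F(1) i by (cases "C i") (auto simp: elementary_def)
    then show ?thesis
      using arrow_chart_arrows assms(2) by blast
  qed
  then show ?thesis
    by (simp add: F(2))
qed

lemma \<sigma>_inverse:
  assumes "f \<in> Cc_smooth"
  shows "\<sigma> (- t) (\<sigma> t f) = f"
proof
  fix a
  have "\<sigma> (- t) (\<sigma> t f) a = modular_phase (- t) a * modular_phase t a * f a"
    by (simp only: \<sigma>_eq mult.assoc)
  then show "\<sigma> (- t) (\<sigma> t f) a = f a"
    using modular_phase_inverse[of a t] Cc_smooth_off_arrows[OF assms, of a]
    by (cases "a \<in> arrows") simp_all
qed

lemma \<phi>_\<sigma>_invariant:
  assumes "\<forall>j\<le>CARD('k). f j \<in> Cc_smooth"
  shows "\<phi> (\<lambda>j. \<sigma> t (f j)) = \<phi> f"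
proof -
  have "cocycle_value (\<lambda>j. \<sigma> t (f j)) I \<longleftrightarrow> cocycle_value f I" for I
  proof
    assume "cocycle_value (\<lambda>j. \<sigma> t (f j)) I"
    then have "cocycle_value (\<lambda>j. \<sigma> (- t) (\<sigma> t (f j))) I"
      by (rule cocycle_value_\<sigma>)
    then show "cocycle_value f I"
      using assms by (simp add: cocycle_value_def \<sigma>_inverse)
  qed (rule cocycle_value_\<sigma>)
  then show ?thesis
    unfolding \<phi>_def cocycle_value_def by presburger
qed

end

theorem proposition14:
  fixes \<A> :: "('m::{t2_space,second_countable_topology}, real^'n::finite) chart set"
    and b :: "'q::finite \<Rightarrow> 'n"
    and T :: "'m set"
    and \<omega> :: "'m \<Rightarrow> ('q \<Rightarrow> ('m, real^'n) chart \<Rightarrow> real^'q) \<Rightarrow> real"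
    and L :: "(real^'q) \<times> (real^'q^'q) \<Rightarrow> (real, 'k::{finite,linorder} option) vec"
    and f :: "nat \<Rightarrow> ('m, 'n, 'q) arrow \<Rightarrow> complex"
    and t :: real
  assumes "CARD('k) = CARD('q) * (CARD('q) + 1) div 2 + CARD('q) - 1"
    and "oriented_foliated_atlas \<A> b"
    and "transversal_data.transversal \<A> b T"
    and "transversal_data.smooth_positive_density \<A> b T \<omega>"
    and "transversal_data.projectively_invariant \<A> b T \<omega>"
    and "transversal_data.fixes_orientation L"
    and "\<forall>j\<le>CARD('k). f j \<in> transversal_data.Cc_smooth \<A> b T \<omega> L"
  shows "transversal_data.\<phi> \<A> b T \<omega> L (\<lambda>j. transversal_data.\<sigma> \<A> b \<omega> t (f j))
       = transversal_data.\<phi> \<A> b T \<omega> L f"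
proof -
  interpret foliated_invariant_density_data \<A> b T \<omega> L
    using assms(2,4,5) by unfold_locales
  show ?thesis
    using assms(7) by (rule \<phi>_\<sigma>_invariant)
qed

end
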